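(* Let $W$ be the affine Weyl group of type $\tilde A_2$, let $w\in W$ be non-spiral, and let $y\le x\le w$. If $q^w_x>0$ then $q^w_y>0$.
   Context: Let $V\cong\mathbb R^2$ be a Euclidean plane with inner product $(\cdot,\cdot)$, containing the root system $\Phi=\{\pm\alpha_1,\pm\alpha_2,\pm\tilde\alpha\}$ of type $A_2$, with simple roots $\alpha_1,\alpha_2$, $\tilde\alpha=\alpha_1+\alpha_2$, $(\alpha,\alpha)=2$ for $\alpha\in\Phi$. For $\alpha\in\Phi$, $k\in\mathbb Z$, $s_{\alpha,k}$ is the orthogonal reflection in the line $H_{\alpha,k}=\{v\mid(\alpha,v)=k\}$. $W$ is the group generated by all $s_{\alpha,k}$, with simple reflections $s_1=s_{\alpha_1,0}$, $s_2=s_{\alpha_2,0}$, $s_0=s_{\tilde\alpha,1}$, length $\ell$ and Bruhat order $\le$; the reflections of $W$ are the $s_{\alpha,k}$. Let $A_0=\{v\mid (v,\alpha_1)>0,(v,\alpha_2)>0,(v,\tilde\alpha)<1\}$. An element $w$ is spiral if $wA_0$ lies in one of the strips $\{v\mid0\le(\alpha,v)\le1\}$, $\alpha\in\{\alpha_1,\alpha_2,\tilde\alpha\}$. For $x\le w$, $n^w_x$ is the number of reflections $r\in W$ with $rx\le w$, and $q^w_x=n^w_x-\ell(w)$. *)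

theory Defs
  imports "HOL-Analysis.Analysis" "HOL-Algebra.Bij" "HOL-Algebra.Generated_Groups"
begin

text \<open>
  Throughout, \<open>a1\<close> and \<open>a2\<close> are the simple roots of a root system of type \<open>A\<^sub>2\<close> in a Euclidean
  plane; every notion below takes them as explicit parameters.  Elements of the affine Weyl group
  are represented as the affine maps of the plane that they are, and the group operation is
  composition of maps.
\<close>

definition A2_roots :: "'a::euclidean_space \<Rightarrow> 'a \<Rightarrow> 'a set" where
  "A2_roots a1 a2 = {a1, - a1, a2, - a2, a1 + a2, - (a1 + a2)}"

text \<open>
  The off-diagonal entry of the Cartan matrix is \<open>-1\<close>; together with the normalization of the
  simple roots this gives \<open>\<alpha> \<bullet> \<alpha> = 2\<close> for all six roots.
\<close>

definition A2_simple_roots :: "'a::euclidean_space \<Rightarrow> 'a \<Rightarrow> bool" where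
  "A2_simple_roots a1 a2 \<longleftrightarrow> a1 \<bullet> a1 = 2 \<and> a2 \<bullet> a2 = 2 \<and> a1 \<bullet> a2 = -1"

text \<open>The orthogonal reflection in the affine hyperplane \<open>{v. \<alpha> \<bullet> v = k}\<close>, for \<open>\<alpha> \<noteq> 0\<close>.\<close>

definition aff_refl :: "'a::euclidean_space \<Rightarrow> int \<Rightarrow> 'a \<Rightarrow> 'a" where
  "aff_refl \<alpha> k v = v - (2 * (\<alpha> \<bullet> v - of_int k) / (\<alpha> \<bullet> \<alpha>)) *\<^sub>R \<alpha>"

definition reflections :: "'a::euclidean_space \<Rightarrow> 'a \<Rightarrow> ('a \<Rightarrow> 'a) set" where
  "reflections a1 a2 = {aff_refl \<alpha> k | \<alpha> k. \<alpha> \<in> A2_roots a1 a2}"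

definition affine_weyl :: "'a::euclidean_space \<Rightarrow> 'a \<Rightarrow> ('a \<Rightarrow> 'a) set" where
  "affine_weyl a1 a2 = generate (BijGroup UNIV) (reflections a1 a2)"

definition simple_reflections :: "'a::euclidean_space \<Rightarrow> 'a \<Rightarrow> ('a \<Rightarrow> 'a) set" where
  "simple_reflections a1 a2 = {aff_refl a1 0, aff_refl a2 0, aff_refl (a1 + a2) 1}"

text \<open>Only meaningful for elements of the affine Weyl group: a \<open>LEAST\<close> over a nonempty set.\<close>

definition weyl_length :: "'a::euclidean_space \<Rightarrow> 'a \<Rightarrow> ('a \<Rightarrow> 'a) \<Rightarrow> nat" where
  "weyl_length a1 a2 w =
     (LEAST n. \<exists>ss. set ss \<subseteq> simple_reflections a1 a2 \<and> length ss = n \<and> w = foldr (\<circ>) ss id)"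

text \<open>
  Bruhat order: the reflexive transitive closure of the relation \<open>u \<rightarrow> r u\<close>, for reflections \<open>r\<close>
  with \<open>\<ell>(u) < \<ell>(r u)\<close>.  As reflections are closed under conjugation, multiplying on the
  right gives the same order.
\<close>

definition bruhat_step :: "'a::euclidean_space \<Rightarrow> 'a \<Rightarrow> ('a \<Rightarrow> 'a) \<Rightarrow> ('a \<Rightarrow> 'a) \<Rightarrow> bool" where
  "bruhat_step a1 a2 u v \<longleftrightarrow>
     (\<exists>r\<in>reflections a1 a2. v = r \<circ> u \<and> weyl_length a1 a2 u < weyl_length a1 a2 v)"

definition bruhat_le :: "'a::euclidean_space \<Rightarrow> 'a \<Rightarrow> ('a \<Rightarrow> 'a) \<Rightarrow> ('a \<Rightarrow> 'a) \<Rightarrow> bool" where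
  "bruhat_le a1 a2 u v \<longleftrightarrow>
     u \<in> affine_weyl a1 a2 \<and> v \<in> affine_weyl a1 a2 \<and> (bruhat_step a1 a2)\<^sup>*\<^sup>* u v"

definition fund_alcove :: "'a::euclidean_space \<Rightarrow> 'a \<Rightarrow> 'a set" where
  "fund_alcove a1 a2 = {v. v \<bullet> a1 > 0 \<and> v \<bullet> a2 > 0 \<and> v \<bullet> (a1 + a2) < 1}"

definition spiral :: "'a::euclidean_space \<Rightarrow> 'a \<Rightarrow> ('a \<Rightarrow> 'a) \<Rightarrow> bool" where
  "spiral a1 a2 w \<longleftrightarrow>
     (\<exists>\<alpha>\<in>{a1, a2, a1 + a2}. w ` fund_alcove a1 a2 \<subseteq> {v. 0 \<le> \<alpha> \<bullet> v \<and> \<alpha> \<bullet> v \<le> 1})"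

text \<open>\<open>refl_count a1 a2 w x\<close> is \<open>n\<^sup>w\<^sub>x\<close>, and \<open>refl_defect a1 a2 w x\<close> is \<open>q\<^sup>w\<^sub>x\<close>.\<close>

definition refl_count :: "'a::euclidean_space \<Rightarrow> 'a \<Rightarrow> ('a \<Rightarrow> 'a) \<Rightarrow> ('a \<Rightarrow> 'a) \<Rightarrow> nat" where
  "refl_count a1 a2 w x = card {r \<in> reflections a1 a2. bruhat_le a1 a2 (r \<circ> x) w}"

definition refl_defect :: "'a::euclidean_space \<Rightarrow> 'a \<Rightarrow> ('a \<Rightarrow> 'a) \<Rightarrow> ('a \<Rightarrow> 'a) \<Rightarrow> int" where
  "refl_defect a1 a2 w x = int (refl_count a1 a2 w x) - int (weyl_length a1 a2 w)"

end

theory Submission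
  imports Defs
begin

text \<open>
  An element of \<open>W\<close> is determined by the image of the centroid of \<open>A\<^sub>0\<close>, and the lines through such a
  point in the three root directions carry its images under reflections.  In suitable integer
  coordinates the Bruhat interval below a non-spiral \<open>w\<close> is a hexagon with sides in the root
  directions: this hexagon is closed under reflections that decrease the length, and
  \<open>w\<close> is its only point from which no reflection inside the hexagon increases the length.  Hence
  \<open>n\<^sup>w\<^sub>x\<close> is a sum of three chord counts, piecewise linear in \<open>x\<close> up to rounding, and comparing it with
  \<open>\<ell>(w)\<close> shows that \<open>{x. q\<^sup>w\<^sub>x > 0}\<close> is empty or a smaller hexagon of the same kind (in one case with eight points near
  its corners removed), which is again closed under reflections that decrease the length.
\<close>

section \<open>Alcoves in integer coordinates\<close>

text \<open>Why \<open>q\<close> should be positive inside: disregard rounding and consider a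
  hexagon with all angles 120 degrees and alternating side lengths a, b. The length of a chord
  parallel to a side is a concave function of its position, and the three chords through a boundary
  point always add up to 2(a+b), which corresponds to the length of \<open>w\<close>. Being concave
  and constant on the boundary, the sum is larger inside if a, b > 0; if a or b is 0, the hexagon is
  a triangle and the sum is constant. Being non-spiral keeps both a and b positive. The obstacle is
  rounding. Reflections of a point along one line are spaced by 3 in each moving coordinate, and the
  margin between the hexagon and the part where \<open>q\<close> is positive is itself at most 3, so
  the continuous picture decides nothing near the boundary. The counts are therefore made exact by
  fixing all residues modulo 3, which leaves integer linear arithmetic with finitely many constants.
  Up to rotation there are two regions for \<open>w\<close> and two orientations, and these four
  families have different margins.\<close>

text \<open>
  An alcove with centroid \<open>c\<close> is encoded by the integers
  \<open>x = (\<alpha>\<^sub>1 + 2\<alpha>\<^sub>2, c) - 1\<close>, \<open>y = 1 - (2\<alpha>\<^sub>1 + \<alpha>\<^sub>2, c)\<close>, \<open>z = (\<alpha>\<^sub>1 - \<alpha>\<^sub>2, c)\<close>, which sum to \<open>0\<close>;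
  \<open>A\<^sub>0\<close> is the origin.  The integers \<open>(1+z-y) div 3\<close>, \<open>(1+x-z) div 3\<close>, \<open>(1+y-x) div 3\<close> are the floors of
  \<open>\<alpha>\<^sub>1\<close>, \<open>\<alpha>\<^sub>2\<close> and \<open>1 - \<alpha>\<^sub>1 - \<alpha>\<^sub>2\<close> on the alcove, so \<open>height\<close> counts separating hyperplanes.  Replacing
  \<open>\<alpha>\<^sub>1 + \<alpha>\<^sub>2\<close> by its complement to \<open>1\<close> makes everything symmetric under the rotation \<open>rot\<close> about the centroid of \<open>A\<^sub>0\<close>.
  The residue of \<open>x - y\<close> modulo \<open>3\<close> is \<open>0\<close> or \<open>2\<close> for the two orientations of an alcove and \<open>1\<close> for
  the vertices of the tessellation.
\<close>

type_synonym coords = "int \<times> int \<times> int"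

fun refl0 :: "int \<Rightarrow> coords \<Rightarrow> coords" where "refl0 k (x,y,z) = (x, z+1-3*k, y-1+3*k)"
fun refl1 :: "int \<Rightarrow> coords \<Rightarrow> coords" where "refl1 k (x,y,z) = (z-1+3*k, y, x+1-3*k)"
fun refl2 :: "int \<Rightarrow> coords \<Rightarrow> coords" where "refl2 k (x,y,z) = (y+1-3*k, x-1+3*k, z)"

fun alcove :: "coords \<Rightarrow> bool" where "alcove (x,y,z) \<longleftrightarrow> x + y + z = 0 \<and> (x - y) mod 3 \<noteq> 1"
fun height :: "coords \<Rightarrow> int" where
  "height (x,y,z) = \<bar>(1+z-y) div 3\<bar> + \<bar>(1+x-z) div 3\<bar> + \<bar>(1+y-x) div 3\<bar>"
declare height.simps [simp del]

fun rot :: "coords \<Rightarrow> coords" where "rot (x,y,z) = (y,z,x)"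

definition reflected :: "coords \<Rightarrow> coords \<Rightarrow> bool" where
  "reflected p q \<longleftrightarrow> (\<exists>k. q = refl0 k p \<or> q = refl1 k p \<or> q = refl2 k p)"

text \<open>The functions \<alpha>1, \<alpha>2 and 1 - \<alpha>1 - \<alpha>2 add up to 1, so their
  floors \<open>i\<close>, \<open>j\<close>, \<open>l\<close> on an alcove add up to 0 or -1, one
  value for each orientation. At the centroid all three have fractional part 1/3 in the first case
  (that of the fundamental alcove) and 2/3 in the second.\<close>

lemma alcove_strips:
  assumes "alcove (x,y,z)"
  obtains i j l where "i + j + l = 0" "z - y = 3*i" "x - z = 3*j" "y - x = 3*l"
  | i j l where "i + j + l = -1" "z - y = 3*i+1" "x - z = 3*j+1" "y - x = 3*l+1"
proof -
  have z: "z = -x-y" and m: "(x-y) mod 3 = 0 \<or> (x-y) mod 3 = 2" using assms by auto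
  define t where "t = (x - y) div 3"
  have "x - y = 3*t \<or> x - y = 3*t+2" using m unfolding t_def by presburger
  then show ?thesis
  proof
    assume t: "x - y = 3*t"
    show ?thesis by (rule that(1)[of "2*t-x" "x-t" "-t"]; use z t in presburger)
  next
    assume t: "x - y = 3*t+2"
    show ?thesis by (rule that(2)[of "2*t-x+1" "x-t-1" "-t-1"]; use z t in presburger)
  qed
qed

lemma div3I: "3*i \<le> t \<Longrightarrow> t \<le> 3*i+2 \<Longrightarrow> t div 3 = (i::int)"
  by linarith

lemma height_strips:
  assumes "(z - y = 3*i \<and> x - z = 3*j \<and> y - x = 3*l) \<or> (z - y = 3*i+1 \<and> x - z = 3*j+1 \<and> y - x = 3*l+1)"
  shows "height (x,y,z) = \<bar>i\<bar> + \<bar>j\<bar> + \<bar>l\<bar>"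
proof -
  have "(1+z-y) div 3 = i" "(1+x-z) div 3 = j" "(1+y-x) div 3 = l" by (rule div3I; use assms in linarith)+
  then show ?thesis by (simp add: height.simps)
qed

lemma height_refl0_strips:
  assumes "(z - y = 3*i \<and> x - z = 3*j \<and> y - x = 3*l) \<or> (z - y = 3*i+1 \<and> x - z = 3*j+1 \<and> y - x = 3*l+1)"
  shows "height (refl0 k (x,y,z)) = \<bar>2*k-1-i\<bar> + \<bar>l+k\<bar> + \<bar>j+k\<bar>"
proof -
  have "(1+(y-1+3*k)-(z+1-3*k)) div 3 = 2*k-1-i"
    "(1+x-(y-1+3*k)) div 3 = -l-k" "(1+(z+1-3*k)-x) div 3 = -j-k"
    by (rule div3I; use assms in presburger)+
  moreover have "\<bar>-l-k\<bar> = \<bar>l+k\<bar>" "\<bar>-j-k\<bar> = \<bar>j+k\<bar>" by linarith+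
  ultimately show ?thesis unfolding refl0.simps height.simps by presburger
qed

text \<open>A reflection shortens exactly if its line separates the alcove from the fundamental one:
  with \<open>i\<close> the floor of \<alpha>1 this means 1 \<le> k \<le> i or i < k \<le>
  0.\<close>

lemma height_refl0_less_iff:
  assumes "alcove (x,y,z)"
  shows "height (refl0 k (x,y,z)) < height (x,y,z) \<longleftrightarrow>
    (z - y \<ge> 0 \<and> 1 \<le> k \<and> 3*k \<le> z - y) \<or> (z - y < 0 \<and> k \<le> 0 \<and> z - y + 1 < 3*k)"
    (is "?l \<longleftrightarrow> ?r")
proof -
  obtain i j l where
    d: "(i + j + l = 0 \<and> z - y = 3*i \<and> x - z = 3*j \<and> y - x = 3*l) \<or>
     (i + j + l = -1 \<and> z - y = 3*i+1 \<and> x - z = 3*j+1 \<and> y - x = 3*l+1)" by (cases rule: alcove_strips[OF assms]) blast+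
  have h: "height (x,y,z) = \<bar>i\<bar> + \<bar>j\<bar> + \<bar>l\<bar>" by (rule height_strips) (use d in linarith)
  have h': "height (refl0 k (x,y,z)) = \<bar>2*k-1-i\<bar> + \<bar>l+k\<bar> + \<bar>j+k\<bar>" by (rule height_refl0_strips) (use d in linarith)
  have s: "i + j + l = 0 \<or> i + j + l = -1" using d by linarith
  have "?l \<longleftrightarrow> (i \<ge> 0 \<and> 1 \<le> k \<and> k \<le> i) \<or> (i < 0 \<and> k \<le> 0 \<and> i < k)"
  proof -
    consider "i \<ge> 0" "k \<le> 0" | "i \<ge> 0" "1 \<le> k" "k \<le> i" | "i \<ge> 0" "i < k"
      | "i < 0" "0 < k" | "i < 0" "k \<le> 0" "i < k" | "i < 0" "k \<le> i" by linarith
    then show ?thesis unfolding h h' using s by cases (smt (verit))+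
  qed
  also have "\<dots> \<longleftrightarrow> ?r" using d by linarith
  finally show ?thesis .
qed

text \<open>The parity of \<open>height\<close> is a sign character: \<open>2*k-1-i\<close> has the
  parity opposite to \<open>i\<close>, while the two shifts by \<open>k\<close> cancel modulo
  2.\<close>

lemma height_refl0_neq:
  assumes "alcove p" shows "height (refl0 k p) \<noteq> height p"
proof -
  obtain x y z where p: "p = (x,y,z)" by (cases p)
  obtain i j l where
    d: "(i + j + l = 0 \<and> z - y = 3*i \<and> x - z = 3*j \<and> y - x = 3*l) \<or>
     (i + j + l = -1 \<and> z - y = 3*i+1 \<and> x - z = 3*j+1 \<and> y - x = 3*l+1)" by (cases rule: alcove_strips[OF assms[unfolded p]]) blast+
  have h: "height (x,y,z) = \<bar>i\<bar> + \<bar>j\<bar> + \<bar>l\<bar>" by (rule height_strips) (use d in linarith)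
  have h': "height (refl0 k (x,y,z)) = \<bar>2*k-1-i\<bar> + \<bar>l+k\<bar> + \<bar>j+k\<bar>" by (rule height_refl0_strips) (use d in linarith)
  have "even (\<bar>2*k-1-i\<bar> + \<bar>l+k\<bar> + \<bar>j+k\<bar>) \<noteq> even (\<bar>i\<bar> + \<bar>j\<bar> + \<bar>l\<bar>)" by (simp; blast)
  then show ?thesis unfolding p h h' by metis
qed

lemma rot_refl: "rot (refl1 k p) = refl0 k (rot p)" "rot (refl2 k p) = refl1 k (rot p)" "rot (refl0 k p) = refl2 k (rot p)"
  by (cases p; simp)+

lemma height_rot [simp]: "height (rot p) = height p" by (cases p) (simp add: height.simps)
lemma alcove_rot [simp]: "alcove (rot p) = alcove p"
proof -
  obtain x y z where p: "p = (x,y,z)" by (cases p)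
  show ?thesis unfolding p by simp presburger
qed

lemma rot_eq_iff [simp]: "rot p = rot q \<longleftrightarrow> p = q" by (cases p; cases q) auto

lemma reflected_rot [simp]: "reflected (rot p) (rot q) = reflected p q"
  unfolding reflected_def rot_refl[symmetric] rot_eq_iff by blast

lemma rot3 [simp]: "rot (rot (rot p)) = p" by (cases p) simp

definition refl_total :: "(coords \<Rightarrow> bool) \<Rightarrow> coords \<Rightarrow> int" where
  "refl_total S p = int (card {k. S (refl0 k p)}) + int (card {k. S (refl1 k p)}) + int (card {k. S (refl2 k p)})"

lemma refl_total_rot: "refl_total S (rot p) = refl_total (S \<circ> rot) p"
  unfolding refl_total_def o_def rot_refl by simp

text \<open>
  \<open>S\<close> certifies the theorem for \<open>w\<close>: the first four conditions force \<open>S\<close> to be the lower Bruhat interval of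
  \<open>w\<close>, whence \<open>refl_total S p\<close> is \<open>n\<^sup>w\<^sub>p\<close>, and the last one is the claim for a single Bruhat step.
\<close>

definition certificate :: "coords \<Rightarrow> (coords \<Rightarrow> bool) \<Rightarrow> bool" where
  "certificate w S \<longleftrightarrow> S w \<and> (\<forall>p q. alcove p \<and> S p \<and> reflected p q \<and> height q < height p \<longrightarrow> S q)
    \<and> (\<forall>p. alcove p \<and> S p \<and> p \<noteq> w \<longrightarrow> (\<exists>q. reflected p q \<and> height p < height q \<and> S q))
    \<and> (\<exists>B. \<forall>p. S p \<longrightarrow> height p \<le> B)
    \<and> (\<forall>p q. alcove p \<and> S p \<and> reflected p q \<and> height q < height p \<and> refl_total S p > height w \<longrightarrow> refl_total S q > height w)"

text \<open>This symmetry reduces the six regions of non-spiral alcoves to two. Precomposition is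
  used, so points supplied for \<open>rot w\<close> are pulled back by \<open>rot\<close> applied
  twice, the inverse of \<open>rot\<close>.\<close>

lemma certificate_rot:
  assumes "certificate (rot w) S" shows "certificate w (S \<circ> rot)"
proof -
  note c = assms[unfolded certificate_def height_rot]
  note 1 = conjunct1[OF c] and 2 = conjunct1[OF conjunct2[OF c], rule_format]
    and 3 = conjunct1[OF conjunct2[OF conjunct2[OF c]], rule_format]
    and 4 = conjunct1[OF conjunct2[OF conjunct2[OF conjunct2[OF c]]]]
    and 5 = conjunct2[OF conjunct2[OF conjunct2[OF conjunct2[OF c]]], rule_format]
  show ?thesis unfolding certificate_def
  proof (intro conjI allI impI)
    show "(S \<circ> rot) w" using 1 by simp
    show "(S \<circ> rot) q" if "alcove p \<and> (S \<circ> rot) p \<and> reflected p q \<and> height q < height p" for p q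
      using 2[of "rot p" "rot q"] that by simp
    show "\<exists>q. reflected p q \<and> height p < height q \<and> (S \<circ> rot) q" if "alcove p \<and> (S \<circ> rot) p \<and> p \<noteq> w" for p
    proof -
      have "alcove (rot p) \<and> S (rot p) \<and> rot p \<noteq> rot w" using that by simp
      then obtain q where q: "reflected (rot p) q" "height (rot p) < height q" "S q" using 3 by metis
      have "reflected p (rot (rot q))" "height p < height (rot (rot q))" "(S \<circ> rot) (rot (rot q))"
        using q reflected_rot[of p "rot (rot q)"] by simp_all
      then show ?thesis by blast
    qed
    show "\<exists>B. \<forall>p. (S \<circ> rot) p \<longrightarrow> height p \<le> B"
    proof -
      from 4 obtain B where B: "\<And>p. S p \<Longrightarrow> height p \<le> B" by blast
      show ?thesis using B[of "rot _"] by (intro exI[of _ B]) simp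
    qed
    show "height w < refl_total (S \<circ> rot) q" if "alcove p \<and> (S \<circ> rot) p \<and> reflected p q \<and> height q < height p \<and> height w < refl_total (S \<circ> rot) p" for p q
      using 5[of "rot p" "rot q"] that unfolding refl_total_rot[symmetric] by simp
  qed
qed

definition hexagon :: "int \<times> int \<times> int \<Rightarrow> int \<times> int \<times> int \<Rightarrow> coords \<Rightarrow> bool" where
  "hexagon = (\<lambda>(u1,u2,u3) (l1,l2,l3) (x,y,z). x+y+z = 0 \<and> l1 \<le> x \<and> x \<le> u1 \<and> l2 \<le> y \<and> y \<le> u2 \<and> l3 \<le> z \<and> z \<le> u3)"

lemma hexagon_rot: "hexagon u l p = hexagon (rot u) (rot l) (rot p)"
  by (cases u; cases l; cases p) (auto simp: hexagon_def)

text \<open>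
  Positions of the sides for which a hexagon is closed under length-decreasing reflections: \<open>(y, z)\<close> is moved at most
  to \<open>(z-2, y+2)\<close> if \<open>y \<le> z\<close>, and at most to \<open>(z+1, y-1)\<close> if \<open>z < y\<close>.
\<close>

fun window :: "int \<times> int \<times> int \<Rightarrow> bool" where
  "window (u,v,w) \<longleftrightarrow> -2 \<le> u - v \<and> u - v \<le> 1 \<and> -2 \<le> v - w \<and> v - w \<le> 1 \<and> -2 \<le> w - u \<and> w - u \<le> 1"

lemma window_rot [simp]: "window (rot u) = window u" by (cases u) auto

lemma hexagon_refl0:
  assumes "window u" "window l" "alcove p" "hexagon u l p" "height (refl0 k p) < height p"
  shows "hexagon u l (refl0 k p)"
proof -
  obtain x y z u1 u2 u3 l1 l2 l3 where e: "p = (x,y,z)" "u = (u1,u2,u3)" "l = (l1,l2,l3)" by (cases p; cases u; cases l)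
  have "(z - y \<ge> 0 \<and> 1 \<le> k \<and> 3*k \<le> z - y) \<or> (z - y < 0 \<and> k \<le> 0 \<and> z - y + 1 < 3*k)"
    using assms height_refl0_less_iff[of x y z k] unfolding e by simp
  moreover have "x+y+z = 0" "l1 \<le> x" "x \<le> u1" "l2 \<le> y" "y \<le> u2" "l3 \<le> z" "z \<le> u3"
    "-2 \<le> u2 - u3" "u2 - u3 \<le> 1" "-2 \<le> l2 - l3" "l2 - l3 \<le> 1"
    using assms(1,2,4) unfolding e hexagon_def by auto
  ultimately show ?thesis unfolding e hexagon_def prod.case refl0.simps by (intro conjI; smt (verit))
qed

lemma hexagon_refl:
  assumes "window u" "window l" "alcove p" "hexagon u l p" "reflected p q" "height q < height p"
  shows "hexagon u l q"
proof -
  from assms(5) obtain k where "q = refl0 k p \<or> q = refl1 k p \<or> q = refl2 k p" unfolding reflected_def by auto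
  then show ?thesis
  proof (elim disjE)
    assume "q = refl0 k p" then show ?thesis using assms hexagon_refl0 by blast
  next
    assume q: "q = refl1 k p"
    have "hexagon (rot u) (rot l) (refl0 k (rot p))"
      by (rule hexagon_refl0; insert assms; unfold hexagon_rot[symmetric] rot_refl[symmetric] q; simp)
    then show ?thesis unfolding q hexagon_rot[of u l "refl1 k p"] rot_refl .
  next
    assume q: "q = refl2 k p"
    have "hexagon (rot (rot u)) (rot (rot l)) (refl0 k (rot (rot p)))"
      by (rule hexagon_refl0; insert assms; unfold hexagon_rot[symmetric] rot_refl[symmetric] q; simp)
    then show ?thesis unfolding q hexagon_rot[of u l "refl2 k p"] hexagon_rot[of "rot u" "rot l"] rot_refl .
  qed
qed

section \<open>Counting reflections in hexagons\<close>

text \<open>A separate constant, to hide the many divisions from linear arithmetic until their arguments are numerals.\<close>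

definition div_three :: "int \<Rightarrow> int" where "div_three x = x div 3"
lemma div_three_simps [simp]: "div_three 0 = 0" "div_three 1 = 0" "div_three 2 = 0" "div_three 3 = 1" "div_three 4 = 1" "div_three 5 = 1" "div_three 6 = 2"
  "div_three (-1) = -1" "div_three (-2) = -1" "div_three (-3) = -1" "div_three (-4) = -2" "div_three (-5) = -2" "div_three (-6) = -2" "div_three (-7) = -3" "div_three (-8) = -3" "div_three (-9) = -3"
  by (simp_all add: div_three_def)

text \<open>The six side conditions of a hexagon, divided by 3 and rounded down. They come from
  \<open>A - x = 3N+g-t\<close>, \<open>A - y = 3(N+H)+g-t+e\<close>,
  \<open>A - z = 3(N-K)+g-t-e\<close>, \<open>B + x = 3M+t\<close>,
  \<open>B + y = 3(M-H)+t-e\<close>, \<open>B + z = 3(M+K)+t+e\<close>, where the \<open>i\<close>'s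
  and \<open>j\<close>'s are the offsets of the sides.\<close>

definition hex_ineqs where "hex_ineqs M N H K t e g i1 i2 i3 j1 j2 j3 \<longleftrightarrow>
  0 \<le> N + div_three (g-t-i1) \<and> 0 \<le> N+H + div_three (g-t+e-i2) \<and> 0 \<le> N-K + div_three (g-t-e-i3)
  \<and> 0 \<le> M + div_three (t-j1) \<and> 0 \<le> M-H + div_three (t-e-j2) \<and> 0 \<le> M+K + div_three (t+e-j3)"

definition tent :: "int \<Rightarrow> int \<Rightarrow> int \<Rightarrow> int \<Rightarrow> int \<Rightarrow> int \<Rightarrow> int" where
  "tent p q a b c d = min (p + a) (q + b) + min (q + c) (p + d)"

text \<open>For strict lower bounds on a count: each minimum is attained, so it suffices to treat
  the four linear pieces. For upper bounds, every piece is available at once, as in the next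
  lemma.\<close>

lemma tent_cases:
  "tent p q a b c d = p+q+(a+c) \<or> tent p q a b c d = p+q+(b+d) \<or> tent p q a b c d = 2*p+(a+d) \<or> tent p q a b c d = 2*q+(b+c)"
  unfolding tent_def by (simp add: min_def)

lemma tent_le:
  "tent p q a b c d \<le> p+q+(a+c)" "tent p q a b c d \<le> p+q+(b+d)" "tent p q a b c d \<le> 2*p+(a+d)" "tent p q a b c d \<le> 2*q+(b+c)"
  unfolding tent_def by (simp_all add: min_def)

text \<open>
  The number of reflections for the hexagons of the types E (\<open>\<alpha>\<^sub>1, \<alpha>\<^sub>2 \<ge> 1\<close> on \<open>wA\<^sub>0\<close>) and V (\<open>\<alpha>\<^sub>1, \<alpha>\<^sub>2 \<le> 0\<close> on
  \<open>wA\<^sub>0\<close>), in the parameters of lemma \<open>hex_parameters\<close> below; these make all distances to the sides of the hexagon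
  equal to three times an integer plus one of finitely many constants.  All other non-spiral alcoves
  are obtained from these by \<open>rot\<close>.
\<close>

definition count_E :: "int \<Rightarrow> int \<Rightarrow> int \<Rightarrow> int \<Rightarrow> int \<Rightarrow> int \<Rightarrow> int \<Rightarrow> int" where
  "count_E M N H K t e g = tent (K+M) (N+H) (div_three (e+t+1)) (div_three (g-t+e-1)) (div_three (g-t-e-2)) (div_three (t-e-3))
     + tent M (N-K) (div_three (t-1)) (div_three (g-t-e+1)) (div_three (g-t-3)) (div_three (t+e-2))
     + tent (M-H) N (div_three (t-e)) (div_three (g-t)) (div_three (g-t+e-1)) (div_three (t-1)) + 3"

definition count_V :: "int \<Rightarrow> int \<Rightarrow> int \<Rightarrow> int \<Rightarrow> int \<Rightarrow> int \<Rightarrow> int \<Rightarrow> int" where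
  "count_V M N H K t e g = tent (K+M) (N+H) (div_three (t+e-1)) (div_three (g-t+e)) (div_three (g-t-e-1)) (div_three (t-e-2))
     + tent M (N-K) (div_three t) (div_three (g-t-e-1)) (div_three (g-t-2)) (div_three (t+e-1))
     + tent (M-H) N (div_three (t-e+1)) (div_three (g-t+1)) (div_three (g-t+e-3)) (div_three (t-3)) + 3"

text \<open>In this and the following comparisons \<open>M + N\<close> is the \<open>n\<close> with
  \<open>A + B = 3n + g\<close>, and the right-hand side is the length of \<open>w\<close>. The last
  two hypotheses bound \<open>A - n\<close> and \<open>B - n\<close> from below, that is, they keep
  \<open>w\<close> away from the strips. Of the offset lists, the one with the smaller numbers is
  the hexagon of the Bruhat interval, the other one the hexagon where the defect is positive. Once
  \<open>t\<close> and \<open>e\<close> are fixed, every \<open>div_three\<close> is a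
  numeral.\<close>

lemma count_E_up_gt:
  fixes M N H K t e :: int
  assumes "t = 0 \<or> t = 1 \<or> t = 2" "e = 0 \<or> e = 2"
    and "hex_ineqs M N H K t e 0 3 4 2 4 3 2"
    and "2*N-M-t+H-K \<ge> 1"
    and "2*M-N+t-H+K \<ge> 1"
  shows "count_E M N H K t e 0 > 2*(M+N)"
  using assms(1,2)
  by (elim disjE; insert tent_cases[of "K+M" "N+H" "div_three (e+t+1)" "div_three (-t+e-1)" "div_three (-t-e-2)" "div_three (t-e-3)"]
      tent_cases[of M "N-K" "div_three (t-1)" "div_three (-t-e+1)" "div_three (-t-3)" "div_three (t+e-2)"]
      tent_cases[of "M-H" N "div_three (t-e)" "div_three (-t)" "div_three (-t+e-1)" "div_three (t-1)"]
      assms(3-); simp add: count_E_def hex_ineqs_def; smt (z3))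

lemma count_E_up_le:
  fixes M N H K t e :: int
  assumes "t = 0 \<or> t = 1 \<or> t = 2" "e = 0 \<or> e = 2"
    and "\<not> hex_ineqs M N H K t e 0 3 4 2 4 3 2"
    and "hex_ineqs M N H K t e 0 0 1 2 1 0 2"
    and "2*N-M-t+H-K \<ge> 1"
    and "2*M-N+t-H+K \<ge> 1"
  shows "count_E M N H K t e 0 \<le> 2*(M+N)"
  using assms(1,2)
  by (elim disjE; insert tent_le[of "K+M" "N+H" "div_three (e+t+1)" "div_three (-t+e-1)" "div_three (-t-e-2)" "div_three (t-e-3)"]
      tent_le[of M "N-K" "div_three (t-1)" "div_three (-t-e+1)" "div_three (-t-3)" "div_three (t+e-2)"]
      tent_le[of "M-H" N "div_three (t-e)" "div_three (-t)" "div_three (-t+e-1)" "div_three (t-1)"]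
      assms(3-); simp add: count_E_def hex_ineqs_def; smt (z3))

lemma count_V_up_gt:
  fixes M N H K t e :: int
  assumes "t = 0 \<or> t = 1 \<or> t = 2" "e = 0 \<or> e = 2"
    and "hex_ineqs M N H K t e 0 4 2 3 2 4 3"
    and "2*N-M-t+H-K \<ge> 1"
    and "2*M-N+t-H+K \<ge> 1"
  shows "count_V M N H K t e 0 > 2*(M+N)"
  using assms(1,2)
  by (elim disjE; insert tent_cases[of "K+M" "N+H" "div_three (t+e-1)" "div_three (-t+e)" "div_three (-t-e-1)" "div_three (t-e-2)"]
      tent_cases[of M "N-K" "div_three t" "div_three (-t-e-1)" "div_three (-t-2)" "div_three (t+e-1)"]
      tent_cases[of "M-H" N "div_three (t-e+1)" "div_three (-t+1)" "div_three (-t+e-3)" "div_three (t-3)"]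
      assms(3-); simp add: count_V_def hex_ineqs_def; smt (z3))

lemma count_V_up_le:
  fixes M N H K t e :: int
  assumes "t = 0 \<or> t = 1 \<or> t = 2" "e = 0 \<or> e = 2"
    and "\<not> hex_ineqs M N H K t e 0 4 2 3 2 4 3"
    and "hex_ineqs M N H K t e 0 2 0 1 0 2 1"
    and "2*N-M-t+H-K \<ge> 1"
    and "2*M-N+t-H+K \<ge> 1"
  shows "count_V M N H K t e 0 \<le> 2*(M+N)"
  using assms(1,2)
  by (elim disjE; insert tent_le[of "K+M" "N+H" "div_three (t+e-1)" "div_three (-t+e)" "div_three (-t-e-1)" "div_three (t-e-2)"]
      tent_le[of M "N-K" "div_three t" "div_three (-t-e-1)" "div_three (-t-2)" "div_three (t+e-1)"]
      tent_le[of "M-H" N "div_three (t-e+1)" "div_three (-t+1)" "div_three (-t+e-3)" "div_three (t-3)"]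
      assms(3-); simp add: count_V_def hex_ineqs_def; smt (z3))

lemma count_V_down_gt:
  fixes M N H K t e :: int
  assumes "t = 0 \<or> t = 1 \<or> t = 2" "e = 0 \<or> e = 2"
    and "hex_ineqs M N H K t e 1 5 3 4 3 5 4"
    and "2*N-M-t+H-K \<ge> 1"
    and "2*M-N+t-H+K \<ge> 2"
  shows "count_V M N H K t e 1 > 2*(M+N)+1"
  using assms(1,2)
  by (elim disjE; insert tent_cases[of "K+M" "N+H" "div_three (t+e-1)" "div_three (1-t+e)" "div_three (1-t-e-1)" "div_three (t-e-2)"]
      tent_cases[of M "N-K" "div_three t" "div_three (1-t-e-1)" "div_three (1-t-2)" "div_three (t+e-1)"]
      tent_cases[of "M-H" N "div_three (t-e+1)" "div_three (1-t+1)" "div_three (1-t+e-3)" "div_three (t-3)"]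
      assms(3-); simp add: count_V_def hex_ineqs_def; smt (z3))

lemma count_V_down_le:
  fixes M N H K t e :: int
  assumes "t = 0 \<or> t = 1 \<or> t = 2" "e = 0 \<or> e = 2"
    and "\<not> hex_ineqs M N H K t e 1 5 3 4 3 5 4"
    and "hex_ineqs M N H K t e 1 2 0 1 0 2 1"
    and "2*N-M-t+H-K \<ge> 0"
    and "2*M-N+t-H+K \<ge> 1"
  shows "count_V M N H K t e 1 \<le> 2*(M+N)+1"
  using assms(1,2)
  by (elim disjE; insert tent_le[of "K+M" "N+H" "div_three (t+e-1)" "div_three (1-t+e)" "div_three (1-t-e-1)" "div_three (t-e-2)"]
      tent_le[of M "N-K" "div_three t" "div_three (1-t-e-1)" "div_three (1-t-2)" "div_three (t+e-1)"]
      tent_le[of "M-H" N "div_three (t-e+1)" "div_three (1-t+1)" "div_three (1-t+e-3)" "div_three (t-3)"]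
      assms(3-); simp add: count_V_def hex_ineqs_def; smt (z3))

text \<open>The case of an alcove adjacent to a strip: here the hexagon is so thin that rounding
  consumes the whole gain inside, and the defect is positive nowhere.\<close>

lemma count_V_down_le_thin:
  fixes M N H K t e :: int
  assumes "t = 0 \<or> t = 1 \<or> t = 2" "e = 0 \<or> e = 2"
    and "\<not> (2*N-M-t+H-K \<ge> 1 \<and> 2*M-N+t-H+K \<ge> 2)"
    and "hex_ineqs M N H K t e 1 2 0 1 0 2 1"
    and "2*N-M-t+H-K \<ge> 0"
    and "2*M-N+t-H+K \<ge> 1"
  shows "count_V M N H K t e 1 \<le> 2*(M+N)+1"
  using assms(1,2)
  by (elim disjE; insert tent_le[of "K+M" "N+H" "div_three (t+e-1)" "div_three (1-t+e)" "div_three (1-t-e-1)" "div_three (t-e-2)"]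
      tent_le[of M "N-K" "div_three t" "div_three (1-t-e-1)" "div_three (1-t-2)" "div_three (t+e-1)"]
      tent_le[of "M-H" N "div_three (t-e+1)" "div_three (1-t+1)" "div_three (1-t+e-3)" "div_three (t-3)"]
      assms(3-); simp add: count_V_def hex_ineqs_def; smt (z3))

text \<open>The two negated hypotheses are the two halves of \<open>near_corner\<close> in the
  parameters; for instance \<open>3*N = t\<close> is x = A-2 and \<open>3*M+t = 3\<close> is x =
  3-B.\<close>

lemma count_E_down_gt:
  fixes M N H K t e :: int
  assumes "t = 0 \<or> t = 1 \<or> t = 2" "e = 0 \<or> e = 2"
  "hex_ineqs M N H K t e 2 2 3 2 3 2 2"
    and "\<not> ((3*N = t \<or> 3*M+t = 3) \<and> (3*(N-M-K)+2-2*t-e = 0 \<or> 3*(N-M-K)+2-2*t-e = -1))"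
    and "\<not> ((3*(N+H)+e-t = 1 \<or> 3*(M-H)+t-e = 2) \<and> (3*(N-M+H-K)+2-2*t = 0 \<or> 3*(N-M+H-K)+2-2*t = 1))"
    and "2*N-M-t+H-K \<ge> 0"
    and "2*M-N+t-H+K \<ge> 2"
  shows "count_E M N H K t e 2 > 2*(M+N)+1"
  using assms(1,2)
  by (elim disjE; insert tent_cases[of "K+M" "N+H" "div_three (e+t+1)" "div_three (2-t+e-1)" "div_three (2-t-e-2)" "div_three (t-e-3)"]
      tent_cases[of M "N-K" "div_three (t-1)" "div_three (2-t-e+1)" "div_three (2-t-3)" "div_three (t+e-2)"]
      tent_cases[of "M-H" N "div_three (t-e)" "div_three (2-t)" "div_three (2-t+e-1)" "div_three (t-1)"]
      assms(3-); simp add: count_E_def hex_ineqs_def; smt (z3))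

lemma count_E_down_le:
  fixes M N H K t e :: int
  assumes "t = 0 \<or> t = 1 \<or> t = 2" "e = 0 \<or> e = 2"
    and "\<not> hex_ineqs M N H K t e 2 2 3 2 3 2 2"
    and "hex_ineqs M N H K t e 2 0 1 2 1 0 2"
    and "2*N-M-t+H-K \<ge> 0"
    and "2*M-N+t-H+K \<ge> 2"
  shows "count_E M N H K t e 2 \<le> 2*(M+N)+1"
  using assms(1,2)
  by (elim disjE; insert tent_le[of "K+M" "N+H" "div_three (e+t+1)" "div_three (2-t+e-1)" "div_three (2-t-e-2)" "div_three (t-e-3)"]
      tent_le[of M "N-K" "div_three (t-1)" "div_three (2-t-e+1)" "div_three (2-t-3)" "div_three (t+e-2)"]
      tent_le[of "M-H" N "div_three (t-e)" "div_three (2-t)" "div_three (2-t+e-1)" "div_three (t-1)"]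
      assms(3-); simp add: count_E_def hex_ineqs_def; smt (z3))

lemma count_E_down_le_corner:
  fixes M N H K t e :: int
  assumes "t = 0 \<or> t = 1 \<or> t = 2" "e = 0 \<or> e = 2"
    and "(3*N = t \<or> 3*M+t = 3) \<and> (3*(N-M-K)+2-2*t-e = 0 \<or> 3*(N-M-K)+2-2*t-e = -1) \<or> (3*(N+H)+e-t = 1 \<or> 3*(M-H)+t-e = 2) \<and> (3*(N-M+H-K)+2-2*t = 0 \<or> 3*(N-M+H-K)+2-2*t = 1)"
    and "hex_ineqs M N H K t e 2 0 1 2 1 0 2"
    and "2*N-M-t+H-K \<ge> 0"
    and "2*M-N+t-H+K \<ge> 2"
  shows "count_E M N H K t e 2 \<le> 2*(M+N)+1"
  using assms(1,2)
  by (elim disjE; insert tent_le[of "K+M" "N+H" "div_three (e+t+1)" "div_three (2-t+e-1)" "div_three (2-t-e-2)" "div_three (t-e-3)"]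
      tent_le[of M "N-K" "div_three (t-1)" "div_three (2-t-e+1)" "div_three (2-t-3)" "div_three (t+e-2)"]
      tent_le[of "M-H" N "div_three (t-e)" "div_three (2-t)" "div_three (2-t+e-1)" "div_three (t-1)"]
      assms(3-); simp add: count_E_def hex_ineqs_def; smt (z3))

section \<open>Chords of a hexagon and their lengths\<close>

definition chord :: "coords \<Rightarrow> coords \<Rightarrow> coords \<Rightarrow> int" where
  "chord = (\<lambda>(u1,u2,u3) (l1,l2,l3) (x,y,z).
     min ((z+1-l2) div 3) ((u3-y+1) div 3) + min ((u2-z-1) div 3) ((y-1-l3) div 3) + 1)"

lemma le_div3_iff: "k \<le> t div 3 \<longleftrightarrow> 3*k \<le> (t::int)" by linarith

lemma card_refl0:
  assumes "hexagon u l p"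
  shows "int (card {k. hexagon u l (refl0 k p)}) = chord u l p"
proof -
  obtain x y z u1 u2 u3 l1 l2 l3 where e: "p = (x,y,z)" "u = (u1,u2,u3)" "l = (l1,l2,l3)"
    by (cases p; cases u; cases l)
  have h: "x+y+z = 0" "l1 \<le> x" "x \<le> u1" "l2 \<le> y" "y \<le> u2" "l3 \<le> z" "z \<le> u3"
    using assms unfolding e hexagon_def by auto
  define A where "A = min ((z+1-l2) div 3) ((u3-y+1) div 3)"
  define C where "C = min ((u2-z-1) div 3) ((y-1-l3) div 3)"
  have "{k. hexagon u l (refl0 k p)} = {-C..A}"
  proof (rule Set.set_eqI)
    fix k
    have "k \<le> A \<longleftrightarrow> 3*k \<le> z+1-l2 \<and> 3*k \<le> u3-y+1" unfolding A_def min.bounded_iff le_div3_iff ..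
    moreover have "-C \<le> k \<longleftrightarrow> -k \<le> C" by linarith
    moreover have "-k \<le> C \<longleftrightarrow> 3*(-k) \<le> u2-z-1 \<and> 3*(-k) \<le> y-1-l3" unfolding C_def min.bounded_iff le_div3_iff ..
    ultimately show "k \<in> {k. hexagon u l (refl0 k p)} \<longleftrightarrow> k \<in> {-C..A}"
      using h unfolding e hexagon_def by auto
  qed
  \<comment> \<open>The cardinality of \<open>{-C..A}\<close> equals \<open>A + C + 1\<close> only
    if this is not negative. Each division by 3 loses at most 2, so 3(A+C) \<ge> -4 for a point
    inside, which is just enough for integers.\<close>
  moreover have "-1 \<le> A + C"
  proof -
    have d: "3 * (t div 3) \<ge> t - 2" for t :: int by linarith
    have "3 * A \<ge> z-1-l2 \<or> 3 * A \<ge> u3-y-1"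
      using d[of "z+1-l2"] d[of "u3-y+1"] unfolding A_def by (auto simp only: min_def split: if_splits)
    moreover have "3 * C \<ge> u2-z-3 \<or> 3 * C \<ge> y-3-l3"
      using d[of "u2-z-1"] d[of "y-1-l3"] unfolding C_def by (auto simp only: min_def split: if_splits)
    ultimately show ?thesis using h by linarith
  qed
  ultimately show ?thesis by (simp add: e chord_def flip: A_def C_def)
qed

lemma refl_total_hexagon:
  assumes "hexagon u l p"
  shows "refl_total (hexagon u l) p = chord u l p + chord (rot u) (rot l) (rot p) + chord (rot (rot u)) (rot (rot l)) (rot (rot p))"
proof -
  have h1: "hexagon (rot u) (rot l) (rot p)" using assms hexagon_rot by simp
  have h2: "hexagon (rot (rot u)) (rot (rot l)) (rot (rot p))" using h1 hexagon_rot by simp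
  have "hexagon u l (refl1 k p) = hexagon (rot u) (rot l) (refl0 k (rot p))" for k
    using hexagon_rot[of u l "refl1 k p"] unfolding rot_refl .
  moreover have "hexagon u l (refl2 k p) = hexagon (rot (rot u)) (rot (rot l)) (refl0 k (rot (rot p)))" for k
    using hexagon_rot[of u l "refl2 k p"] hexagon_rot[of "rot u" "rot l" "rot (refl2 k p)"] unfolding rot_refl by simp
  ultimately show ?thesis unfolding refl_total_def card_refl0[OF assms, symmetric] card_refl0[OF h1, symmetric] card_refl0[OF h2, symmetric]
    by presburger
qed

lemma div3_div_three: "c = 3*q + r \<Longrightarrow> c div 3 = q + div_three r"
  by (simp add: div_three_def)

lemma tent_shift: "min (p+a) (q+b) + min ((q+s)+c) ((p+s)+d) = tent p q a b c d + s"
  unfolding tent_def by (simp add: min_def)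

lemma chord_tent:
  assumes "z+1-l2 = 3*p+a" "u3-y+1 = 3*q+b" "u2-z-1 = 3*(q+s)+c" "y-1-l3 = 3*(p+s)+d"
  shows "chord (u1,u2,u3) (l1,l2,l3) (x,y,z) = tent p q (div_three a) (div_three b) (div_three c) (div_three d) + s + 1"
  unfolding chord_def prod.case div3_div_three[OF assms(1)] div3_div_three[OF assms(2)] div3_div_three[OF assms(3)] div3_div_three[OF assms(4)]
  using tent_shift by simp

lemma alcove_refl0 [simp]: "alcove (refl0 k p) = alcove p"
proof -
  obtain x y z where p: "p = (x,y,z)" by (cases p)
  have "(x - (z+1-3*k)) mod 3 \<noteq> 1 \<longleftrightarrow> (x-y) mod 3 \<noteq> 1" if "x+y+z=0"
  proof -
    have "x - (z+1-3*k) = 2*x + y - 1 + 3*k" using that by simp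
    then show ?thesis by presburger
  qed
  then show ?thesis unfolding p by auto
qed

lemma alcove_refl [simp]: "alcove (refl1 k p) = alcove p" "alcove (refl2 k p) = alcove p"
  by (metis alcove_rot alcove_refl0 rot_refl)+

lemma alcove_reflected: "reflected p q \<Longrightarrow> alcove q = alcove p"
  unfolding reflected_def by auto

lemma height_refl0_greater:
  assumes "alcove (x,y,z)" "(z - y \<ge> 0 \<and> (k \<le> 0 \<or> 3*k > z - y)) \<or> (z - y < 0 \<and> (k \<ge> 1 \<or> 3*k \<le> z - y + 1))"
  shows "height (x,y,z) < height (refl0 k (x,y,z))"
proof -
  have "\<not> height (refl0 k (x,y,z)) < height (x,y,z)" unfolding height_refl0_less_iff[OF assms(1)] using assms(2) by linarith
  with height_refl0_neq[OF assms(1), of k] show ?thesis by linarith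
qed

lemma height_refl1_greater:
  assumes "alcove (x,y,z)" "(x - z \<ge> 0 \<and> (k \<le> 0 \<or> 3*k > x - z)) \<or> (x - z < 0 \<and> (k \<ge> 1 \<or> 3*k \<le> x - z + 1))"
  shows "height (x,y,z) < height (refl1 k (x,y,z))"
  using height_refl0_greater[of y z x k] assms alcove_rot[of "(x,y,z)"] height_rot[of "(x,y,z)"] height_rot[of "refl1 k (x,y,z)"]
  unfolding rot_refl by simp

lemma height_refl2_greater:
  assumes "alcove (x,y,z)" "(y - x \<ge> 0 \<and> (k \<le> 0 \<or> 3*k > y - x)) \<or> (y - x < 0 \<and> (k \<ge> 1 \<or> 3*k \<le> y - x + 1))"
  shows "height (x,y,z) < height (refl2 k (x,y,z))"
  using height_refl1_greater[of y z x k] assms alcove_rot[of "(x,y,z)"] height_rot[of "(x,y,z)"] height_rot[of "refl2 k (x,y,z)"]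
  unfolding rot_refl by simp

section \<open>Hexagons given by two sizes and fixed offsets\<close>

definition hex_off :: "int \<Rightarrow> int \<Rightarrow> coords \<Rightarrow> coords \<Rightarrow> coords \<Rightarrow> bool" where
  "hex_off A B = (\<lambda>(i1,i2,i3) (j1,j2,j3). hexagon (A-i1,A-i2,A-i3) (j1-B,j2-B,j3-B))"

lemma hex_off_iff: "hex_off A B (i1,i2,i3) (j1,j2,j3) (x,y,z) \<longleftrightarrow> x+y+z = 0 \<and> j1-B \<le> x \<and> x \<le> A-i1 \<and> j2-B \<le> y \<and> y \<le> A-i2 \<and> j3-B \<le> z \<and> z \<le> A-i3"
  by (simp add: hex_off_def hexagon_def)

lemma abs_div3_le: "\<bar>t div 3\<bar> \<le> \<bar>t::int\<bar>" by linarith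

lemma height_bounded: "\<exists>C. \<forall>p. hex_off A B i j p \<longrightarrow> height p \<le> C"
proof -
  obtain i1 i2 i3 j1 j2 j3 where e: "i = (i1,i2,i3)" "j = (j1,j2,j3)" by (cases i; cases j)
  define C where "C = \<bar>A-i1\<bar> + \<bar>j1-B\<bar> + \<bar>A-i2\<bar> + \<bar>j2-B\<bar> + \<bar>A-i3\<bar> + \<bar>j3-B\<bar>"
  have "height (x,y,z) \<le> C+C+3" if "hex_off A B i j (x,y,z)" for x y z
  proof -
    have 1: "\<bar>x\<bar> \<le> \<bar>A-i1\<bar> + \<bar>j1-B\<bar>" "\<bar>y\<bar> \<le> \<bar>A-i2\<bar> + \<bar>j2-B\<bar>" "\<bar>z\<bar> \<le> \<bar>A-i3\<bar> + \<bar>j3-B\<bar>"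
      using that unfolding e hex_off_iff by linarith+
    have "\<bar>1+z-y\<bar> \<le> 1+\<bar>z\<bar>+\<bar>y\<bar>" "\<bar>1+x-z\<bar> \<le> 1+\<bar>x\<bar>+\<bar>z\<bar>" "\<bar>1+y-x\<bar> \<le> 1+\<bar>y\<bar>+\<bar>x\<bar>" by linarith+
    then have "height (x,y,z) \<le> 3 + 2*\<bar>x\<bar> + 2*\<bar>y\<bar> + 2*\<bar>z\<bar>"
      using abs_div3_le[of "1+z-y"] abs_div3_le[of "1+x-z"] abs_div3_le[of "1+y-x"] unfolding height.simps by linarith
    then show ?thesis using 1 unfolding C_def by linarith
  qed
  then show ?thesis by (intro exI[of _ "C+C+3"]) auto
qed

text \<open>\<open>t\<close> and \<open>M\<close> are remainder and quotient of x + B modulo 3,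
  \<open>e\<close> and \<open>H\<close> those of x - y; the value \<open>e = 1\<close> is excluded
  because it belongs to a vertex of the tessellation. The remaining parameters
  \<open>K = H - x\<close> and \<open>N = n - M\<close> are then forced.\<close>

lemma hex_parameters:
  fixes A B n g :: int
  assumes "A + B = 3*n + g" "alcove (x,y,z)"
  obtains M N H K t e where "t = 0 \<or> t = 1 \<or> t = 2" "e = 0 \<or> e = 2" "x = H-K" "y = -2*H-K-e" "z = H+2*K+e"
    "A = 3*N+g-t+H-K" "B = 3*M+t-H+K" "n = M+N"
proof -
  have z: "x+y+z=0" and xy: "(x-y) mod 3 = 0 \<or> (x-y) mod 3 = 2" using assms(2) by auto
  define t M where "t = (x+B) mod 3" and "M = (x+B) div 3"
  have B: "x+B = 3*M+t" "t = 0 \<or> t = 1 \<or> t = 2" unfolding t_def M_def by presburger+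
  define e H where "e = (x-y) mod 3" and "H = (x-y) div 3"
  have H: "x-y = 3*H+e" "e = 0 \<or> e = 2" using xy unfolding e_def H_def by presburger+
  show ?thesis by (rule that[of t e H "H-x" "n-M" M]) (use B H z assms(1) in presburger)+
qed

lemma hex_off_iff_ineqs:
  assumes "t = 0 \<or> t = 1 \<or> t = 2" "x = H-K" "y = -2*H-K-e" "z = H+2*K+e"
    "A = 3*N+g-t+H-K" "B = 3*M+t-H+K"
  shows "hex_off A B (i1,i2,i3) (j1,j2,j3) (x,y,z) = hex_ineqs M N H K t e g i1 i2 i3 j1 j2 j3"
proof -
  have f: "0 \<le> s + div_three c \<longleftrightarrow> 0 \<le> 3 * s + c" for s c unfolding div_three_def by linarith
  show ?thesis unfolding hex_off_iff hex_ineqs_def f using assms(2-) by (auto simp: algebra_simps)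
qed

text \<open>\<open>Q\<close> is an explicit description of the points of positive defect. With it
  the last condition of a certificate becomes closure of \<open>Q\<close> under shortening
  reflections, and the counts enter only through the equivalence.\<close>

lemma certificateI:
  assumes "alcove w" "hex_off A B i j w"
   and win: "\<And>A B. window (A-fst i, A - fst (snd i), A - snd (snd i))" "\<And>A B. window (fst j-B, fst (snd j)-B, snd (snd j)-B)"
   and max: "\<And>p. alcove p \<Longrightarrow> hex_off A B i j p \<Longrightarrow> \<forall>q. reflected p q \<and> height p < height q \<longrightarrow> \<not> hex_off A B i j q \<Longrightarrow> p = w"
   and Q: "\<And>p. alcove p \<Longrightarrow> hex_off A B i j p \<Longrightarrow> refl_total (hex_off A B i j) p > height w \<longleftrightarrow> Q p"
   and low: "\<And>p q. alcove p \<Longrightarrow> hex_off A B i j p \<Longrightarrow> Q p \<Longrightarrow> reflected p q \<Longrightarrow> height q < height p \<Longrightarrow> Q q"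
  shows "certificate w (hex_off A B i j)"
proof -
  have l: "hex_off A B i j q" if "alcove p" "hex_off A B i j p" "reflected p q" "height q < height p" for p q
  proof -
    obtain i1 i2 i3 j1 j2 j3 where e: "i = (i1,i2,i3)" "j = (j1,j2,j3)" by (cases i; cases j)
    show ?thesis using hexagon_refl[OF win[unfolded e fst_conv snd_conv] that(1) _ that(3,4)] that(2)
      unfolding e hex_off_def by simp
  qed
  show ?thesis unfolding certificate_def
  proof (intro conjI allI impI; (elim conjE)?)
    show "hex_off A B i j w" by fact
    show "hex_off A B i j q" if "alcove p" "hex_off A B i j p" "reflected p q" "height q < height p" for p q using l[OF that] .
    show "\<exists>q. reflected p q \<and> height p < height q \<and> hex_off A B i j q" if "alcove p" "hex_off A B i j p" "p \<noteq> w" for p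
      using max[OF that(1,2)] that(3) by blast
    show "\<exists>C. \<forall>p. hex_off A B i j p \<longrightarrow> height p \<le> C" by (rule height_bounded)
    show "height w < refl_total (hex_off A B i j) q" if "alcove p" "hex_off A B i j p" "reflected p q" "height q < height p" "height w < refl_total (hex_off A B i j) p" for p q
      using low[OF that(1,2) _ that(3,4)] Q[OF that(1,2)] that(5) Q[of q] l[OF that(1-4)] alcove_reflected[OF that(3)] that(1) by blast
  qed
qed

text \<open>The shifts in the three directions are \<open>-(H+K)\<close>, \<open>K\<close> and
  \<open>H\<close> and cancel in the sum; the constant 3 in \<open>count_E\<close> counts one for
  each chord.\<close>

lemma refl_total_E:
  assumes "x = H-K" "y = -2*H-K-e" "z = H+2*K+e" "A = 3*N+g-t+H-K" "B = 3*M+t-H+K"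
   "hex_off A B (0,1,2) (1,0,2) (x,y,z)"
  shows "refl_total (hex_off A B (0,1,2) (1,0,2)) (x,y,z) = count_E M N H K t e g"
proof -
  have h: "hex_off A B (0,1,2) (1,0,2) = hexagon (A-0,A-1,A-2) (1-B,0-B,2-B)" unfolding hex_off_def by simp
  have "chord (A-0,A-1,A-2) (1-B,0-B,2-B) (x,y,z) =
    tent (K+M) (N+H) (div_three (e+t+1)) (div_three (g-t+e-1)) (div_three (g-t-e-2)) (div_three (t-e-3)) + -(H+K) + 1"
    by (rule chord_tent; simp add: assms(1-5) algebra_simps)
  moreover have "chord (A-1,A-2,A-0) (0-B,2-B,1-B) (y,z,x) =
    tent M (N-K) (div_three (t-1)) (div_three (g-t-e+1)) (div_three (g-t-3)) (div_three (t+e-2)) + K + 1"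
    by (rule chord_tent; simp add: assms(1-5) algebra_simps)
  moreover have "chord (A-2,A-0,A-1) (2-B,1-B,0-B) (z,x,y) =
    tent (M-H) N (div_three (t-e)) (div_three (g-t)) (div_three (g-t+e-1)) (div_three (t-1)) + H + 1"
    by (rule chord_tent; simp add: assms(1-5) algebra_simps)
  ultimately show ?thesis unfolding h refl_total_hexagon[OF assms(6)[unfolded h]] rot.simps count_E_def by linarith
qed

lemma refl_total_V:
  assumes "x = H-K" "y = -2*H-K-e" "z = H+2*K+e" "A = 3*N+g-t+H-K" "B = 3*M+t-H+K"
   "hex_off A B (2,0,1) (0,2,1) (x,y,z)"
  shows "refl_total (hex_off A B (2,0,1) (0,2,1)) (x,y,z) = count_V M N H K t e g"
proof -
  have h: "hex_off A B (2,0,1) (0,2,1) = hexagon (A-2,A-0,A-1) (0-B,2-B,1-B)" unfolding hex_off_def by simp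
  have "chord (A-2,A-0,A-1) (0-B,2-B,1-B) (x,y,z) =
    tent (K+M) (N+H) (div_three (t+e-1)) (div_three (g-t+e)) (div_three (g-t-e-1)) (div_three (t-e-2)) + -(H+K) + 1"
    by (rule chord_tent; simp add: assms(1-5) algebra_simps)
  moreover have "chord (A-0,A-1,A-2) (2-B,1-B,0-B) (y,z,x) =
    tent M (N-K) (div_three t) (div_three (g-t-e-1)) (div_three (g-t-2)) (div_three (t+e-1)) + K + 1"
    by (rule chord_tent; simp add: assms(1-5) algebra_simps)
  moreover have "chord (A-1,A-2,A-0) (1-B,0-B,2-B) (z,x,y) =
    tent (M-H) N (div_three (t-e+1)) (div_three (g-t+1)) (div_three (g-t+e-3)) (div_three (t-3)) + H + 1"
    by (rule chord_tent; simp add: assms(1-5) algebra_simps)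
  ultimately show ?thesis unfolding h refl_total_hexagon[OF assms(6)[unfolded h]] rot.simps count_V_def by linarith
qed

section \<open>The unique maximal element of a hexagon\<close>

lemma mod3: "(v::int) mod 3 \<noteq> 1 \<Longrightarrow> v mod 3 = 0 \<or> v mod 3 = 2" by presburger

text \<open>The offsets are read off from w = (A,-B,B-A) and three shortening reflections of it: w
  itself attains x = A and y = -B, \<open>refl2 0\<close> leads to y = A-1 and x = 1-B,
  \<open>refl1 1\<close> to z = A-2, and \<open>refl0 1\<close> to z = 2-B. So each side contains
  \<open>w\<close> or one of these images.\<close>

lemma hex_E_unique_max:
  assumes p: "alcove p" "hex_off A B (0,1,2) (1,0,2) p" "\<forall>q. reflected p q \<and> height p < height q \<longrightarrow> \<not> hex_off A B (0,1,2) (1,0,2) q"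
    and "3 \<le> 2*A-B" "3 \<le> 2*B-A" "(A+B) mod 3 \<noteq> 1"
  shows "p = (A,-B,B-A)"
proof -
  obtain x y z where e: "p = (x,y,z)" by (cases p)
  obtain i j l f where f: "f = 0 \<or> f = 1" "i + j + l = -f" "z - y = 3*i+f" "x - z = 3*j+f" "y - x = 3*l+f"
  proof (cases rule: alcove_strips[OF p(1)[unfolded e]])
    case (1 i j l) then show ?thesis using that[of 0 i j l] by simp
  next
    case (2 i j l) then show ?thesis using that[of 1 i j l] by simp
  qed
  have a: "alcove (x,y,z)" using p e by simp
  let ?S = "hex_off A B (0,1,2) (1,0,2)"
  have b0: "\<not> ?S (refl0 k (x,y,z))" if "(z - y \<ge> 0 \<and> (k \<le> 0 \<or> 3*k > z - y)) \<or> (z - y < 0 \<and> (k \<ge> 1 \<or> 3*k \<le> z - y + 1))" for k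
    using p(3) height_refl0_greater[OF a that] unfolding e reflected_def by blast
  have b1: "\<not> ?S (refl1 k (x,y,z))" if "(x - z \<ge> 0 \<and> (k \<le> 0 \<or> 3*k > x - z)) \<or> (x - z < 0 \<and> (k \<ge> 1 \<or> 3*k \<le> x - z + 1))" for k
    using p(3) height_refl1_greater[OF a that] unfolding e reflected_def by blast
  have b2: "\<not> ?S (refl2 k (x,y,z))" if "(y - x \<ge> 0 \<and> (k \<le> 0 \<or> 3*k > y - x)) \<or> (y - x < 0 \<and> (k \<ge> 1 \<or> 3*k \<le> y - x + 1))" for k
    using p(3) height_refl2_greater[OF a that] unfolding e reflected_def by blast
  have S: "x+y+z=0" "1-B \<le> x" "x \<le> A" "-B \<le> y" "y \<le> A-1" "2-B \<le> z" "z \<le> A-2"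
    using p(2) unfolding e hex_off_iff by auto
  \<comment> \<open>\<open>refl2 0\<close>, the reflection in the line through an edge of the
    fundamental alcove, maps the hexagon to itself. A maximal point hence lies beyond that
    line.\<close>
  have "y < x"
  proof (rule ccontr)
    assume "\<not> y < x"
    then show False using b2[of 0] S unfolding refl2.simps hex_off_iff by simp
  qed
  then have "l < 0" using f by linarith
  have d2: "x+f+1 > A \<or> y-f-1 < -B"
    using b2[of l] S f(1,5) \<open>y < x\<close> \<open>l < 0\<close> unfolding refl2.simps hex_off_iff by auto
  \<comment> \<open>The indices of lengthening reflections form two rays, ending at \<open>0\<close>
    and \<open>i+1\<close> if z \<ge> y and at \<open>i\<close> and \<open>1\<close> otherwise. The
    ends of the rays move the point least, and these suffice.\<close>
  have d0: "z \<ge> y \<and> y \<le> 2-B \<and> (y+f-2 < -B \<or> z-f+2 > A-2) \<or> z < y \<and> y \<ge> A-3 \<and> (y+f+1 > A-1 \<or> z-f-1 < 2-B)"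
  proof (cases "z \<ge> y")
    case True
    then show ?thesis using b0[of 0] b0[of "i+1"] S f(1,3) unfolding refl0.simps hex_off_iff by auto
  next
    case False
    then show ?thesis using b0[of 1] b0[of i] S f(1,3) unfolding refl0.simps hex_off_iff by auto
  qed
  have d1: "x \<ge> z \<and> x \<ge> A-2 \<and> (z+f-2 < 2-B \<or> x-f+2 > A) \<or> x < z \<and> x \<le> 3-B \<and> (z+f+1 > A-2 \<or> x-f-1 < 1-B)"
  proof (cases "x \<ge> z")
    case True
    then show ?thesis using b1[of 0] b1[of "j+1"] S f(1,4) unfolding refl1.simps hex_off_iff by auto
  next
    case False
    then show ?thesis using b1[of 1] b1[of j] S f(1,4) unfolding refl1.simps hex_off_iff by auto
  qed
  obtain n g where g: "A+B = 3*n+g" "g = 0 \<or> g = 2"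
    using assms(6) by (metis mult_div_mod_eq mod3)
  obtain M N H K t u where P: "t = 0 \<or> t = 1 \<or> t = 2" "u = 0 \<or> u = 2" "x = H-K" "y = -2*H-K-u" "z = H+2*K+u"
    "A = 3*N+g-t+H-K" "B = 3*M+t-H+K" "n = M+N" by (rule hex_parameters[OF g(1) a])
  have "(u = 0 \<and> f = 0) \<or> (u = 2 \<and> f = 1)" using P(2,3,4) f(1,5) by (smt (z3))
  then have "x = A \<and> y = -B"
  proof -
    assume "(u = 0 \<and> f = 0) \<or> (u = 2 \<and> f = 1)"
    then consider "u = 0" "f = 0" | "u = 2" "f = 1" by blast
    then show ?thesis
    proof cases
      case 1
      from P(1) g(2) show ?thesis
        by (elim disjE; insert d0 d1 d2 S assms(4,5); unfold P(3-7) 1; simp; smt (z3))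
    next
      case 2
      from P(1) g(2) show ?thesis
        by (elim disjE; insert d0 d1 d2 S assms(4,5); unfold P(3-7) 2; simp; smt (z3))
    qed
  qed
  then show ?thesis using p(2) unfolding e hex_off_iff by auto
qed

text \<open>In the coordinates of the plane, x + 1, y - 1 and z, all upper bounds of this hexagon
  are A-1 and all lower bounds 1-B. It is the convex hull of the orbit of the centroid of w =
  (-B,A,B-A) under the finite Weyl group fixing the origin.\<close>

lemma hex_V_unique_max:
  assumes p: "alcove p" "hex_off A B (2,0,1) (0,2,1) p" "\<forall>q. reflected p q \<and> height p < height q \<longrightarrow> \<not> hex_off A B (2,0,1) (0,2,1) q"
    and "2 \<le> 2*A-B" "2 \<le> 2*B-A" "(A+B) mod 3 \<noteq> 2"
  shows "p = (-B,A,B-A)"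
proof -
  obtain x y z where e: "p = (x,y,z)" by (cases p)
  obtain i j l f where f: "f = 0 \<or> f = 1" "i + j + l = -f" "z - y = 3*i+f" "x - z = 3*j+f" "y - x = 3*l+f"
  proof (cases rule: alcove_strips[OF p(1)[unfolded e]])
    case (1 i j l) then show ?thesis using that[of 0 i j l] by simp
  next
    case (2 i j l) then show ?thesis using that[of 1 i j l] by simp
  qed
  have a: "alcove (x,y,z)" using p e by simp
  let ?S = "hex_off A B (2,0,1) (0,2,1)"
  have b0: "\<not> ?S (refl0 k (x,y,z))" if "(z - y \<ge> 0 \<and> (k \<le> 0 \<or> 3*k > z - y)) \<or> (z - y < 0 \<and> (k \<ge> 1 \<or> 3*k \<le> z - y + 1))" for k
    using p(3) height_refl0_greater[OF a that] unfolding e reflected_def by blast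
  have b1: "\<not> ?S (refl1 k (x,y,z))" if "(x - z \<ge> 0 \<and> (k \<le> 0 \<or> 3*k > x - z)) \<or> (x - z < 0 \<and> (k \<ge> 1 \<or> 3*k \<le> x - z + 1))" for k
    using p(3) height_refl1_greater[OF a that] unfolding e reflected_def by blast
  have b2: "\<not> ?S (refl2 k (x,y,z))" if "(y - x \<ge> 0 \<and> (k \<le> 0 \<or> 3*k > y - x)) \<or> (y - x < 0 \<and> (k \<ge> 1 \<or> 3*k \<le> y - x + 1))" for k
    using p(3) height_refl2_greater[OF a that] unfolding e reflected_def by blast
  have S: "x+y+z=0" "-B \<le> x" "x \<le> A-2" "2-B \<le> y" "y \<le> A" "1-B \<le> z" "z \<le> A-1"
    using p(2) unfolding e hex_off_iff by auto
  \<comment> \<open>The reflections \<open>refl2 1\<close>, \<open>refl0 0\<close> and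
    \<open>refl1 0\<close> in the three lines through the origin map the hexagon to itself.
    Maximality therefore puts the point into the chamber x < z < y opposite to the fundamental
    alcove.\<close>
  have y: "y \<ge> x"
  proof (rule ccontr)
    assume "\<not> y \<ge> x"
    then show False using b2[of 1] S unfolding refl2.simps hex_off_iff by simp
  qed
  have zy: "z < y"
  proof (rule ccontr)
    assume "\<not> z < y"
    then show False using b0[of 0] S unfolding refl0.simps hex_off_iff by simp
  qed
  have xz: "x < z"
  proof (rule ccontr)
    assume "\<not> x < z"
    then show False using b1[of 0] S unfolding refl1.simps hex_off_iff by simp
  qed
  have d0: "y+f+1 > A \<or> z-f-1 < 1-B" "z-2 < 2-B \<or> y+2 > A-1"
    using b0[of i] b0[of 1] S f(1,3) zy unfolding refl0.simps hex_off_iff by auto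
  have d1: "z+f+1 > A-1 \<or> x-f-1 < -B" "x-2 < 1-B \<or> z+2 > A-2"
    using b1[of j] b1[of 1] S f(1,4) xz unfolding refl1.simps hex_off_iff by auto
  have d2: "x+f-2 < -B \<or> y-f+2 > A" "y+1 > A-2 \<or> x-1 < 2-B"
    using b2[of "l+1"] b2[of 0] S f(1,5) y unfolding refl2.simps hex_off_iff by auto
  have "(A+B) mod 3 = 0 \<or> (A+B) mod 3 = 1" using assms(6) by presburger
  then obtain n g where g: "A+B = 3*n+g" "g = 0 \<or> g = 1"
    by (metis mult_div_mod_eq)
  obtain M N H K t u where P: "t = 0 \<or> t = 1 \<or> t = 2" "u = 0 \<or> u = 2" "x = H-K" "y = -2*H-K-u" "z = H+2*K+u"
    "A = 3*N+g-t+H-K" "B = 3*M+t-H+K" "n = M+N" by (rule hex_parameters[OF g(1) a])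
  have "(u = 0 \<and> f = 0) \<or> (u = 2 \<and> f = 1)" using P(2,3,4) f(1,5) by (smt (z3))
  then consider "u = 0" "f = 0" | "u = 2" "f = 1" by blast
  then have "x = -B \<and> y = A"
  proof cases
    case 1
    from P(1) g(2) show ?thesis
      by (elim disjE; insert d0 d1 d2 S assms(4,5) y zy xz; unfold P(3-7) 1; simp; smt (z3))
  next
    case 2
    from P(1) g(2) show ?thesis
      by (elim disjE; insert d0 d1 d2 S assms(4,5) y zy xz; unfold P(3-7) 2; simp; smt (z3))
  qed
  then show ?thesis using p(2) unfolding e hex_off_iff by auto
qed

lemma height_refl1_less_iff:
  assumes "alcove (x,y,z)"
  shows "height (refl1 k (x,y,z)) < height (x,y,z) \<longleftrightarrow>
    (x - z \<ge> 0 \<and> 1 \<le> k \<and> 3*k \<le> x - z) \<or> (x - z < 0 \<and> k \<le> 0 \<and> x - z + 1 < 3*k)"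
  using height_refl0_less_iff[of y z x k] assms alcove_rot[of "(x,y,z)"] height_rot[of "(x,y,z)"] height_rot[of "refl1 k (x,y,z)"]
  unfolding rot_refl by simp

lemma height_refl2_less_iff:
  assumes "alcove (x,y,z)"
  shows "height (refl2 k (x,y,z)) < height (x,y,z) \<longleftrightarrow>
    (y - x \<ge> 0 \<and> 1 \<le> k \<and> 3*k \<le> y - x) \<or> (y - x < 0 \<and> k \<le> 0 \<and> y - x + 1 < 3*k)"
  using height_refl1_less_iff[of y z x k] assms alcove_rot[of "(x,y,z)"] height_rot[of "(x,y,z)"] height_rot[of "refl2 k (x,y,z)"]
  unfolding rot_refl by simp

text \<open>If \<open>w\<close> is of type E and has the orientation opposite to \<open>A\<^sub>0\<close>, then \<open>q\<close> also vanishes at these eight points,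
  two near each of four corners of the hexagon that otherwise describes \<open>q > 0\<close>.\<close>

fun near_corner :: "int \<Rightarrow> int \<Rightarrow> coords \<Rightarrow> bool" where
  "near_corner A B (x,y,z) \<longleftrightarrow> (x = A-2 \<or> x = 3-B) \<and> (y = B-A \<or> y = B-A-1)
    \<or> (y = A-3 \<or> y = 2-B) \<and> (x = B-A \<or> x = B-A+1)"

text \<open>Removing points from a set closed under shortening reflections keeps it closed if the
  removed points are closed upwards inside it. That is what is shown: only points of the exceptional
  set lie above points of it.\<close>

lemma near_corner_upward:
  assumes "alcove p" "hex_off A B (2,3,2) (3,2,2) p" "reflected p q" "height q < height p" "near_corner A B q"
    "A + B = 3*n+2" "A - n \<ge> 2" "B - n \<ge> 2"
  shows "near_corner A B p"
proof -
  obtain x y z where e: "p = (x,y,z)" by (cases p)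
  have a: "alcove (x,y,z)" using assms(1) e by simp
  have S: "x+y+z=0" "3-B \<le> x" "x \<le> A-2" "2-B \<le> y" "y \<le> A-3" "2-B \<le> z" "z \<le> A-2"
    using assms(2) unfolding e hex_off_iff by auto
  from assms(3) obtain k where "q = refl0 k p \<or> q = refl1 k p \<or> q = refl2 k p" unfolding reflected_def by blast
  then show ?thesis
  proof (elim disjE)
    assume q: "q = refl0 k p"
    have "(z - y \<ge> 0 \<and> 1 \<le> k \<and> 3*k \<le> z - y) \<or> (z - y < 0 \<and> k \<le> 0 \<and> z - y + 1 < 3*k)"
      using assms(4) unfolding q e height_refl0_less_iff[OF a] .
    then show ?thesis using assms(5-8) S unfolding q e refl0.simps near_corner.simps by (smt (z3))
  next
    assume q: "q = refl1 k p"
    have "(x - z \<ge> 0 \<and> 1 \<le> k \<and> 3*k \<le> x - z) \<or> (x - z < 0 \<and> k \<le> 0 \<and> x - z + 1 < 3*k)"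
      using assms(4) unfolding q e height_refl1_less_iff[OF a] .
    then show ?thesis using assms(5-8) S unfolding q e refl1.simps near_corner.simps by (smt (z3))
  next
    assume q: "q = refl2 k p"
    have "(y - x \<ge> 0 \<and> 1 \<le> k \<and> 3*k \<le> y - x) \<or> (y - x < 0 \<and> k \<le> 0 \<and> y - x + 1 < 3*k)"
      using assms(4) unfolding q e height_refl2_less_iff[OF a] .
    then show ?thesis using assms(5-8) S unfolding q e refl2.simps near_corner.simps by (smt (z3))
  qed
qed

lemma hex_off_lower:
  assumes "window (A-i1,A-i2,A-i3)" "window (j1-B,j2-B,j3-B)" "alcove p" "hex_off A B (i1,i2,i3) (j1,j2,j3) p" "reflected p q" "height q < height p"
  shows "hex_off A B (i1,i2,i3) (j1,j2,j3) q"
  using hexagon_refl[OF assms(1,2,3) _ assms(5,6)] assms(4) unfolding hex_off_def by simp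

section \<open>Certificates for the two regions and the two orientations\<close>

lemma height_E:
  assumes "A + B = 3*n+g" "(g = 0 \<and> A - n \<ge> 1 \<and> B - n \<ge> 1) \<or> (g = 2 \<and> A - n \<ge> 2 \<and> B - n \<ge> 2)"
  shows "height (A,-B,B-A) = 2*n + g div 2"
proof -
  consider "g = 0" "A - n \<ge> 1" "B - n \<ge> 1" | "g = 2" "A - n \<ge> 2" "B - n \<ge> 2" using assms(2) by blast
  then show ?thesis
  proof cases
    case 1
    have "height (A,-B,B-A) = \<bar>B-n\<bar> + \<bar>A-n\<bar> + \<bar>-n\<bar>" by (rule height_strips) (use 1 assms(1) in presburger)
    then show ?thesis using 1 assms(1) by linarith
  next
    case 2
    have "height (A,-B,B-A) = \<bar>B-n-1\<bar> + \<bar>A-n-1\<bar> + \<bar>-n-1\<bar>" by (rule height_strips) (use 2 assms(1) in presburger)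
    then show ?thesis using 2 assms(1) by linarith
  qed
qed

lemma height_V:
  assumes "A + B = 3*n+g" "g = 0 \<or> g = 1" "A - n \<ge> 1" "B - n \<ge> 1"
  shows "height (-B,A,B-A) = 2*n + g"
proof -
  have "height (-B,A,B-A) = \<bar>n-A\<bar> + \<bar>n-B\<bar> + \<bar>n\<bar>" by (rule height_strips) (use assms in presburger)
  then show ?thesis using assms by linarith
qed

text \<open>The symmetry \<open>refl2 0\<close> exchanges only x and y, so the z-sides can behave
  differently: passing to \<open>Q\<close> moves the x- and y-sides inwards by 3 and leaves the
  z-sides in place.\<close>

lemma certificate_E_up:
  assumes n: "A + B = 3*n" "A - n \<ge> 1" "B - n \<ge> 1"
  shows "certificate (A,-B,B-A) (hex_off A B (0,1,2) (1,0,2))"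
proof (rule certificateI[where Q = "hex_off A B (3,4,2) (4,3,2)"])
  show "alcove (A,-B,B-A)" using n by simp
  show "hex_off A B (0,1,2) (1,0,2) (A,-B,B-A)" using n unfolding hex_off_iff by auto
  show "p = (A,-B,B-A)" if "alcove p" "hex_off A B (0,1,2) (1,0,2) p" "\<forall>q. reflected p q \<and> height p < height q \<longrightarrow> \<not> hex_off A B (0,1,2) (1,0,2) q" for p
    by (rule hex_E_unique_max[OF that]) (use n in auto)
  show "height (A,-B,B-A) < refl_total (hex_off A B (0,1,2) (1,0,2)) p \<longleftrightarrow> hex_off A B (3,4,2) (4,3,2) p"
    if p: "alcove p" "hex_off A B (0,1,2) (1,0,2) p" for p
  proof -
    obtain x y z where e: "p = (x,y,z)" by (cases p)
    have h: "height (A,-B,B-A) = 2*n" using height_E[of A B n 0] n by simp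
    obtain M N H K t e' where P: "t = 0 \<or> t = 1 \<or> t = 2" "e' = 0 \<or> e' = 2" "x = H-K" "y = -2*H-K-e'" "z = H+2*K+e'"
      "A = 3*N+0-t+H-K" "B = 3*M+t-H+K" "n = M+N"
      by (rule hex_parameters[of A B n 0 x y z]) (use n p(1) e in simp_all)
    have c: "refl_total (hex_off A B (0,1,2) (1,0,2)) (x,y,z) = count_E M N H K t e' 0"
      by (rule refl_total_E[OF P(3-7)]) (use p e in simp)
    have w: "2*N-M-t+H-K \<ge> 1" "2*M-N+t-H+K \<ge> 1" using n P by linarith+
    note hh = hex_off_iff_ineqs[OF P(1,3-7)]
    have S: "hex_ineqs M N H K t e' 0 0 1 2 1 0 2" using p(2) e hh by simp
    have "count_E M N H K t e' 0 > 2*(M+N)" if "hex_ineqs M N H K t e' 0 3 4 2 4 3 2"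
      using count_E_up_gt[OF P(1,2) that w] by simp
    moreover have "count_E M N H K t e' 0 \<le> 2*(M+N)" if "\<not> hex_ineqs M N H K t e' 0 3 4 2 4 3 2"
      using count_E_up_le[OF P(1,2) that S w] by simp
    ultimately show ?thesis unfolding h e c hh P(8) by (meson linorder_not_less)
  qed
  show "hex_off A B (3,4,2) (4,3,2) q" if "alcove p" "hex_off A B (3,4,2) (4,3,2) p" "reflected p q" "height q < height p" for p q
    by (rule hex_off_lower[OF _ _ that]) simp_all
qed simp_all

text \<open>Compared with the other orientation the x- and y-sides move only by 2, at the price of
  the exceptional points near corners; the z-sides again stay.\<close>

lemma certificate_E_down:
  assumes n: "A + B = 3*n+2" "A - n \<ge> 2" "B - n \<ge> 2"
  shows "certificate (A,-B,B-A) (hex_off A B (0,1,2) (1,0,2))"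
proof (rule certificateI[where Q = "\<lambda>p. hex_off A B (2,3,2) (3,2,2) p \<and> \<not> near_corner A B p"])
  have m: "(A+B) mod 3 = 2" unfolding n(1) by simp
  show "alcove (A,-B,B-A)" using m by simp
  show "hex_off A B (0,1,2) (1,0,2) (A,-B,B-A)" using n unfolding hex_off_iff by auto
  show "p = (A,-B,B-A)" if "alcove p" "hex_off A B (0,1,2) (1,0,2) p" "\<forall>q. reflected p q \<and> height p < height q \<longrightarrow> \<not> hex_off A B (0,1,2) (1,0,2) q" for p
    by (rule hex_E_unique_max[OF that]) (use n m in auto)
  show "height (A,-B,B-A) < refl_total (hex_off A B (0,1,2) (1,0,2)) p \<longleftrightarrow> hex_off A B (2,3,2) (3,2,2) p \<and> \<not> near_corner A B p"
    if p: "alcove p" "hex_off A B (0,1,2) (1,0,2) p" for p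
  proof -
    obtain x y z where e: "p = (x,y,z)" by (cases p)
    have h: "height (A,-B,B-A) = 2*n+1" using height_E[of A B n 2] n by simp
    obtain M N H K t e' where P: "t = 0 \<or> t = 1 \<or> t = 2" "e' = 0 \<or> e' = 2" "x = H-K" "y = -2*H-K-e'" "z = H+2*K+e'"
      "A = 3*N+2-t+H-K" "B = 3*M+t-H+K" "n = M+N"
      by (rule hex_parameters[of A B n 2 x y z]) (use n p(1) e in simp_all)
    have c: "refl_total (hex_off A B (0,1,2) (1,0,2)) (x,y,z) = count_E M N H K t e' 2"
      by (rule refl_total_E[OF P(3-7)]) (use p e in simp)
    have w: "2*N-M-t+H-K \<ge> 0" "2*M-N+t-H+K \<ge> 2" using n P by linarith+
    note hh = hex_off_iff_ineqs[OF P(1,3-7)]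
    let ?e1 = "(3*N = t \<or> 3*M+t = 3) \<and> (3*(N-M-K)+2-2*t-e' = 0 \<or> 3*(N-M-K)+2-2*t-e' = -1)"
    let ?e2 = "(3*(N+H)+e'-t = 1 \<or> 3*(M-H)+t-e' = 2) \<and> (3*(N-M+H-K)+2-2*t = 0 \<or> 3*(N-M+H-K)+2-2*t = 1)"
    have "x = A-2 \<longleftrightarrow> 3*N = t" "x = 3-B \<longleftrightarrow> 3*M+t = 3"
      "y = B-A \<longleftrightarrow> 3*(N-M-K)+2-2*t-e' = 0" "y = B-A-1 \<longleftrightarrow> 3*(N-M-K)+2-2*t-e' = -1"
      "y = A-3 \<longleftrightarrow> 3*(N+H)+e'-t = 1" "y = 2-B \<longleftrightarrow> 3*(M-H)+t-e' = 2"
      "x = B-A \<longleftrightarrow> 3*(N-M+H-K)+2-2*t = 0" "x = B-A+1 \<longleftrightarrow> 3*(N-M+H-K)+2-2*t = 1"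
      unfolding P(3,4,6,7) by (smt (verit))+
    then have x: "near_corner A B (x,y,z) \<longleftrightarrow> ?e1 \<or> ?e2" by simp
    have S: "hex_ineqs M N H K t e' 2 0 1 2 1 0 2" using p(2) e hh by simp
    have "count_E M N H K t e' 2 > 2*(M+N)+1" if "hex_ineqs M N H K t e' 2 2 3 2 3 2 2" "\<not> ?e1" "\<not> ?e2"
      by (rule count_E_down_gt[OF P(1,2) that w])
    moreover have "count_E M N H K t e' 2 \<le> 2*(M+N)+1" if "\<not> hex_ineqs M N H K t e' 2 2 3 2 3 2 2"
      by (rule count_E_down_le[OF P(1,2) that S w])
    moreover have "count_E M N H K t e' 2 \<le> 2*(M+N)+1" if "?e1 \<or> ?e2"
      by (rule count_E_down_le_corner[OF P(1,2) _ S w]) (use that in blast)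
    ultimately show ?thesis
      unfolding h e c hh P(8) x by (meson linorder_not_less)
  qed
  show "hex_off A B (2,3,2) (3,2,2) q \<and> \<not> near_corner A B q"
    if "alcove p" "hex_off A B (2,3,2) (3,2,2) p \<and> \<not> near_corner A B p" "reflected p q" "height q < height p" for p q
    using near_corner_upward[OF that(1) _ that(3,4) _ n] hex_off_lower[OF _ _ that(1) _ that(3,4), of A 2 3 2 3 B 2 2] that(2) by (simp del: near_corner.simps) blast
qed simp_all

text \<open>By the symmetry under the finite Weyl group all upper sides move by the same amount, and
  so do all lower sides; the margin is 2.\<close>

lemma certificate_V_up:
  assumes n: "A + B = 3*n" "A - n \<ge> 1" "B - n \<ge> 1"
  shows "certificate (-B,A,B-A) (hex_off A B (2,0,1) (0,2,1))"
proof (rule certificateI[where Q = "hex_off A B (4,2,3) (2,4,3)"])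
  have "(-B-A) mod 3 = 0" using n by presburger
  then show "alcove (-B,A,B-A)" by simp
  show "hex_off A B (2,0,1) (0,2,1) (-B,A,B-A)" using n unfolding hex_off_iff by auto
  show "p = (-B,A,B-A)" if "alcove p" "hex_off A B (2,0,1) (0,2,1) p" "\<forall>q. reflected p q \<and> height p < height q \<longrightarrow> \<not> hex_off A B (2,0,1) (0,2,1) q" for p
    by (rule hex_V_unique_max[OF that]) (use n in auto)
  show "height (-B,A,B-A) < refl_total (hex_off A B (2,0,1) (0,2,1)) p \<longleftrightarrow> hex_off A B (4,2,3) (2,4,3) p"
    if p: "alcove p" "hex_off A B (2,0,1) (0,2,1) p" for p
  proof -
    obtain x y z where e: "p = (x,y,z)" by (cases p)
    have h: "height (-B,A,B-A) = 2*n" using height_V[of A B n 0] n by simp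
    obtain M N H K t e' where P: "t = 0 \<or> t = 1 \<or> t = 2" "e' = 0 \<or> e' = 2" "x = H-K" "y = -2*H-K-e'" "z = H+2*K+e'"
      "A = 3*N+0-t+H-K" "B = 3*M+t-H+K" "n = M+N"
      by (rule hex_parameters[of A B n 0 x y z]) (use n p(1) e in simp_all)
    have c: "refl_total (hex_off A B (2,0,1) (0,2,1)) (x,y,z) = count_V M N H K t e' 0"
      by (rule refl_total_V[OF P(3-7)]) (use p e in simp)
    have w: "2*N-M-t+H-K \<ge> 1" "2*M-N+t-H+K \<ge> 1" using n P by linarith+
    note hh = hex_off_iff_ineqs[OF P(1,3-7)]
    have S: "hex_ineqs M N H K t e' 0 2 0 1 0 2 1" using p(2) e hh by simp
    have "count_V M N H K t e' 0 > 2*(M+N)" if "hex_ineqs M N H K t e' 0 4 2 3 2 4 3"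
      using count_V_up_gt[OF P(1,2) that w] by simp
    moreover have "count_V M N H K t e' 0 \<le> 2*(M+N)" if "\<not> hex_ineqs M N H K t e' 0 4 2 3 2 4 3"
      using count_V_up_le[OF P(1,2) that S w] by simp
    ultimately show ?thesis unfolding h e c hh P(8) by (meson linorder_not_less)
  qed
  show "hex_off A B (4,2,3) (2,4,3) q" if "alcove p" "hex_off A B (4,2,3) (2,4,3) p" "reflected p q" "height q < height p" for p q
    by (rule hex_off_lower[OF _ _ that]) simp_all
qed simp_all

text \<open>The margin is 3. The conditions on \<open>A - n\<close> and \<open>B - n\<close> in
  \<open>Q\<close> do not involve the point: if one of them fails, \<open>w\<close> is adjacent to a
  strip and \<open>Q\<close> has to be empty.\<close>

lemma certificate_V_down:
  assumes n: "A + B = 3*n+1" "A - n \<ge> 1" "B - n \<ge> 1"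
  shows "certificate (-B,A,B-A) (hex_off A B (2,0,1) (0,2,1))"
proof (rule certificateI[where Q = "\<lambda>p. hex_off A B (5,3,4) (3,5,4) p \<and> A - n \<ge> 2 \<and> B - n \<ge> 2"])
  have "(-B-A) mod 3 = 2" using n by presburger
  then show "alcove (-B,A,B-A)" by simp
  show "hex_off A B (2,0,1) (0,2,1) (-B,A,B-A)" using n unfolding hex_off_iff by auto
  have m: "(A+B) mod 3 = 1" unfolding n(1) by simp
  show "p = (-B,A,B-A)" if "alcove p" "hex_off A B (2,0,1) (0,2,1) p" "\<forall>q. reflected p q \<and> height p < height q \<longrightarrow> \<not> hex_off A B (2,0,1) (0,2,1) q" for p
    by (rule hex_V_unique_max[OF that]) (use n m in auto)
  show "height (-B,A,B-A) < refl_total (hex_off A B (2,0,1) (0,2,1)) p \<longleftrightarrow> hex_off A B (5,3,4) (3,5,4) p \<and> A - n \<ge> 2 \<and> B - n \<ge> 2"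
    if p: "alcove p" "hex_off A B (2,0,1) (0,2,1) p" for p
  proof -
    obtain x y z where e: "p = (x,y,z)" by (cases p)
    have h: "height (-B,A,B-A) = 2*n+1" using height_V[of A B n 1] n by simp
    obtain M N H K t e' where P: "t = 0 \<or> t = 1 \<or> t = 2" "e' = 0 \<or> e' = 2" "x = H-K" "y = -2*H-K-e'" "z = H+2*K+e'"
      "A = 3*N+1-t+H-K" "B = 3*M+t-H+K" "n = M+N"
      by (rule hex_parameters[of A B n 1 x y z]) (use n p(1) e in simp_all)
    have c: "refl_total (hex_off A B (2,0,1) (0,2,1)) (x,y,z) = count_V M N H K t e' 1"
      by (rule refl_total_V[OF P(3-7)]) (use p e in simp)
    have w: "2*N-M-t+H-K \<ge> 0" "2*M-N+t-H+K \<ge> 1" using n P by linarith+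
    have w2: "A - n \<ge> 2 \<longleftrightarrow> 2*N-M-t+H-K \<ge> 1" "B - n \<ge> 2 \<longleftrightarrow> 2*M-N+t-H+K \<ge> 2" using P by linarith+
    note hh = hex_off_iff_ineqs[OF P(1,3-7)]
    have S: "hex_ineqs M N H K t e' 1 2 0 1 0 2 1" using p(2) e hh by simp
    have "count_V M N H K t e' 1 > 2*(M+N)+1" if "hex_ineqs M N H K t e' 1 5 3 4 3 5 4" "2*N-M-t+H-K \<ge> 1" "2*M-N+t-H+K \<ge> 2"
      by (rule count_V_down_gt[OF P(1,2) that])
    moreover have "count_V M N H K t e' 1 \<le> 2*(M+N)+1" if "\<not> hex_ineqs M N H K t e' 1 5 3 4 3 5 4"
      by (rule count_V_down_le[OF P(1,2) that S w])
    moreover have "count_V M N H K t e' 1 \<le> 2*(M+N)+1" if "\<not> (2*N-M-t+H-K \<ge> 1 \<and> 2*M-N+t-H+K \<ge> 2)"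
      by (rule count_V_down_le_thin[OF P(1,2) that S w])
    ultimately show ?thesis
      unfolding w2 unfolding h e c hh P(8) by (meson linorder_not_less)
  qed
  show "hex_off A B (5,3,4) (3,5,4) q \<and> A - n \<ge> 2 \<and> B - n \<ge> 2"
    if "alcove p" "hex_off A B (5,3,4) (3,5,4) p \<and> A - n \<ge> 2 \<and> B - n \<ge> 2" "reflected p q" "height q < height p" for p q
    using hex_off_lower[OF _ _ that(1) _ that(3,4), of A 5 3 4 3 B 5 4] that(2) by simp
qed simp_all

lemma certificate_exists_EV:
  assumes "alcove (x,y,z)" "((1+z-y) div 3 \<ge> 1 \<and> (1+x-z) div 3 \<ge> 1) \<or> ((1+z-y) div 3 \<le> -1 \<and> (1+x-z) div 3 \<le> -1)"
  shows "\<exists>S. certificate (x,y,z) S"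
proof -
  obtain i j l f where f: "f = 0 \<or> f = 1" "i + j + l = -f" "z - y = 3*i+f" "x - z = 3*j+f" "y - x = 3*l+f"
  proof (cases rule: alcove_strips[OF assms(1)])
    case (1 i j l) then show ?thesis using that[of 0 i j l] by simp
  next
    case (2 i j l) then show ?thesis using that[of 1 i j l] by simp
  qed
  have s: "x+y+z = 0" using assms(1) by simp
  have "(1+z-y) div 3 = i" "(1+x-z) div 3 = j" by (rule div3I; use f in linarith)+
  with assms(2) consider "i \<ge> 1" "j \<ge> 1" "f = 0" | "i \<ge> 1" "j \<ge> 1" "f = 1" | "i \<le> -1" "j \<le> -1" "f = 0" | "i \<le> -1" "j \<le> -1" "f = 1"
    using f(1) by auto
  then show ?thesis
  \<comment> \<open>The sizes A and B are the extreme coordinates of \<open>w\<close> up to sign,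
    and \<open>n\<close> is the quotient of A + B by 3. For type E this is x - y = -3l - f, so f = 1
    gives n = -l-1 with remainder 2; for type V it is y - x = 3l + f with n = l.\<close>
  proof cases
    case 1
    have "certificate (x,-(-y),-y-x) (hex_off x (-y) (0,1,2) (1,0,2))"
      by (rule certificate_E_up[of x "-y" "-l"]) (use 1 s f in linarith)+
    moreover have "z = -y-x" using s by simp
    ultimately show ?thesis by auto
  next
    case 2
    have "certificate (x,-(-y),-y-x) (hex_off x (-y) (0,1,2) (1,0,2))"
      by (rule certificate_E_down[of x "-y" "-l-1"]) (use 2 s f in \<open>smt (verit)\<close>)+
    moreover have "z = -y-x" using s by simp
    ultimately show ?thesis by auto
  next
    case 3
    have "certificate (-(-x),y,-x-y) (hex_off y (-x) (2,0,1) (0,2,1))"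
      by (rule certificate_V_up[of y "-x" "l"]) (use 3 s f in linarith)+
    moreover have "z = -x-y" using s by simp
    ultimately show ?thesis by auto
  next
    case 4
    have "certificate (-(-x),y,-x-y) (hex_off y (-x) (2,0,1) (0,2,1))"
      by (rule certificate_V_down[of y "-x" "l"]) (use 4 s f in linarith)+
    moreover have "z = -x-y" using s by simp
    ultimately show ?thesis by auto
  qed
qed

theorem certificate_exists:
  assumes "alcove (x,y,z)" "(1+z-y) div 3 \<noteq> 0" "(1+x-z) div 3 \<noteq> 0" "(1+y-x) div 3 \<noteq> 0"
  shows "\<exists>S. certificate (x,y,z) S"
proof -
  define i j l where d: "i = (1+z-y) div 3" "j = (1+x-z) div 3" "l = (1+y-x) div 3"
  have s: "x+y+z = 0" using assms(1) by simp
  have nz: "i \<noteq> 0" "j \<noteq> 0" "l \<noteq> 0" using assms d by simp_all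
  have a: "alcove (y,z,x)" "alcove (z,x,y)" using assms(1) alcove_rot[of "(x,y,z)"] alcove_rot[of "(y,z,x)"] by simp_all
  \<comment> \<open>Among three nonzero integers two have the same sign; a rotation brings this pair
    to the first two places.\<close>
  consider "(i \<ge> 1 \<and> j \<ge> 1) \<or> (i \<le> -1 \<and> j \<le> -1)" | "(j \<ge> 1 \<and> l \<ge> 1) \<or> (j \<le> -1 \<and> l \<le> -1)"
    | "(l \<ge> 1 \<and> i \<ge> 1) \<or> (l \<le> -1 \<and> i \<le> -1)" using nz by linarith
  then show ?thesis
  proof cases
    case 1 then show ?thesis using certificate_exists_EV[OF assms(1)] unfolding d by blast
  next
    case 2
    then obtain S where "certificate (y,z,x) S" using certificate_exists_EV[OF a(1)] unfolding d by blast
    then show ?thesis using certificate_rot[of "(x,y,z)" S] by auto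
  next
    case 3
    then obtain S where "certificate (z,x,y) S" using certificate_exists_EV[OF a(2)] unfolding d by blast
    then show ?thesis using certificate_rot[of "(y,z,x)" S] certificate_rot[of "(x,y,z)" "S \<circ> rot"] by auto
  qed
qed

section \<open>The simple reflections, which all have index 0 in these coordinates\<close>

lemma height_refl0_0:
  assumes "alcove (x,y,z)"
  shows "height (refl0 0 (x,y,z)) = height (x,y,z) + (if z - y < 0 then -1 else 1)"
proof -
  obtain i j l where
    d: "(i + j + l = 0 \<and> z - y = 3*i \<and> x - z = 3*j \<and> y - x = 3*l) \<or>
     (i + j + l = -1 \<and> z - y = 3*i+1 \<and> x - z = 3*j+1 \<and> y - x = 3*l+1)" by (cases rule: alcove_strips[OF assms]) blast+
  have h: "height (x,y,z) = \<bar>i\<bar> + \<bar>j\<bar> + \<bar>l\<bar>" by (rule height_strips) (use d in linarith)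
  have h': "height (refl0 0 (x,y,z)) = \<bar>2*0-1-i\<bar> + \<bar>l+0\<bar> + \<bar>j+0\<bar>" by (rule height_refl0_strips) (use d in linarith)
  have "z - y < 0 \<longleftrightarrow> i < 0" using d by linarith
  then show ?thesis unfolding h h' by simp
qed

lemma height_refl1_0:
  assumes "alcove (x,y,z)"
  shows "height (refl1 0 (x,y,z)) = height (x,y,z) + (if x - z < 0 then -1 else 1)"
  using height_refl0_0[of y z x] assms alcove_rot[of "(x,y,z)"] height_rot[of "(x,y,z)"] height_rot[of "refl1 0 (x,y,z)"]
  unfolding rot_refl by simp

lemma height_refl2_0:
  assumes "alcove (x,y,z)"
  shows "height (refl2 0 (x,y,z)) = height (x,y,z) + (if y - x < 0 then -1 else 1)"
  using height_refl1_0[of y z x] assms alcove_rot[of "(x,y,z)"] height_rot[of "(x,y,z)"] height_rot[of "refl2 0 (x,y,z)"]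
  unfolding rot_refl by simp

lemma height_simple_le:
  assumes "alcove p" shows "height (refl0 0 p) \<le> height p + 1" "height (refl1 0 p) \<le> height p + 1" "height (refl2 0 p) \<le> height p + 1"
  by (cases p; use assms height_refl0_0 height_refl1_0 height_refl2_0 in force)+

text \<open>The three differences of coordinates add up to 0. If none is negative they all vanish,
  and with x + y + z = 0 the point is the origin.\<close>

lemma height_descent:
  assumes "alcove p" "p \<noteq> (0,0,0)"
  shows "height (refl0 0 p) = height p - 1 \<or> height (refl1 0 p) = height p - 1 \<or> height (refl2 0 p) = height p - 1"
proof -
  obtain x y z where p: "p = (x,y,z)" by (cases p)
  have a: "alcove (x,y,z)" using assms p by simp
  have "z - y < 0 \<or> x - z < 0 \<or> y - x < 0"
    using assms(2) a unfolding p by auto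
  then show ?thesis unfolding p height_refl0_0[OF a] height_refl1_0[OF a] height_refl2_0[OF a] by auto
qed

lemma finite_height_refl: "finite {k. height (refl0 k p) \<le> C}" "finite {k. height (refl1 k p) \<le> C}" "finite {k. height (refl2 k p) \<le> C}"
proof -
  have f: "finite {k. height (refl0 k p) \<le> C}" for p
  proof -
    obtain x y z where p: "p = (x,y,z)" by (cases p)
    have "{k. height (refl0 k p) \<le> C} \<subseteq> {- (\<bar>C\<bar> + \<bar>y\<bar> + \<bar>z\<bar> + 3) .. \<bar>C\<bar> + \<bar>y\<bar> + \<bar>z\<bar> + 3}"
    proof
      fix k assume "k \<in> {k. height (refl0 k p) \<le> C}"
      then have "\<bar>(1+(y-1+3*k)-(z+1-3*k)) div 3\<bar> \<le> C" unfolding p refl0.simps height.simps mem_Collect_eq by linarith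
      moreover have "1+(y-1+3*k)-(z+1-3*k) = (y-z-1) + 3*(2*k)" by simp
      ultimately have "\<bar>(y-z-1) div 3 + 2*k\<bar> \<le> C" by simp
      moreover have "\<bar>(y-z-1) div 3\<bar> \<le> \<bar>y\<bar> + \<bar>z\<bar> + 1" by linarith
      ultimately show "k \<in> {- (\<bar>C\<bar> + \<bar>y\<bar> + \<bar>z\<bar> + 3) .. \<bar>C\<bar> + \<bar>y\<bar> + \<bar>z\<bar> + 3}" by simp linarith
    qed
    then show ?thesis by (rule finite_subset) simp
  qed
  show "finite {k. height (refl0 k p) \<le> C}" by (rule f)
  have "height (refl1 k p) = height (refl0 k (rot p))" "height (refl2 k p) = height (refl0 k (rot (rot p)))" for k
    using height_rot[of "refl1 k p"] height_rot[of "refl2 k p"] height_rot[of "rot (refl2 k p)"] unfolding rot_refl by simp_all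
  then show "finite {k. height (refl1 k p) \<le> C}" "finite {k. height (refl2 k p) \<le> C}" using f by simp_all
qed

section \<open>The affine Weyl group\<close>

locale A2_plane =
  fixes a1 a2 :: "'a::euclidean_space"
  assumes dim2: "DIM('a) = 2" and simple: "A2_simple_roots a1 a2"
begin

lemma inner_simps: "a1 \<bullet> a1 = 2" "a2 \<bullet> a2 = 2" "a1 \<bullet> a2 = -1" "a2 \<bullet> a1 = -1"
  using simple by (auto simp: A2_simple_roots_def inner_commute)

text \<open>Here the dimension enters: two independent roots span the plane.\<close>

lemma orthogonal_roots_imp_zero:
  assumes "a1 \<bullet> v = 0" "a2 \<bullet> v = 0" shows "v = 0"
proof -
  have "a2 \<noteq> 0" using inner_simps by auto
  moreover have "a1 \<notin> span {a2}"
  proof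
    assume "a1 \<in> span {a2}"
    then obtain k where k: "a1 = k *\<^sub>R a2" by (auto simp: span_singleton)
    have "a1 \<bullet> a2 = k * 2" using arg_cong[OF k, of "\<lambda>v. v \<bullet> a2"] inner_simps by simp
    moreover have "a1 \<bullet> a1 = k * (-1)" using arg_cong[OF k, of "\<lambda>v. v \<bullet> a1"] inner_simps by simp
    ultimately show False using inner_simps by simp
  qed
  ultimately have ind: "independent {a1,a2}" by (simp add: independent_insert)
  have "a1 \<noteq> a2" using inner_simps by auto
  then have "UNIV \<subseteq> span {a1,a2}"
    using card_ge_dim_independent[of "{a1,a2}" "UNIV::'a set"] ind dim2 by simp
  then have "orthogonal v v"
    using orthogonal_to_span[of v "{a1,a2}" v] assms by (auto simp: orthogonal_def inner_commute)
  then show ?thesis by (simp add: orthogonal_def)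
qed

text \<open>The usual model of A2 by triples with sum 0, scaled by 3 so that centroids of alcoves
  become integral. Differences of coordinates are 3 times the roots, and a reflection exchanges two
  coordinates and shifts them by opposite multiples of 3.\<close>

definition co :: "nat \<Rightarrow> 'a \<Rightarrow> real" where
  "co i v = (if i = 0 then a1 + 2 *\<^sub>R a2 else if i = 1 then - (2 *\<^sub>R a1 + a2) else a1 - a2) \<bullet> v"

lemma co_roots: "a1 \<bullet> v = (co 2 v - co 1 v) / 3" "a2 \<bullet> v = (co 0 v - co 2 v) / 3"
  "(a1 + a2) \<bullet> v = (co 0 v - co 1 v) / 3"
  by (simp_all add: co_def inner_simps algebra_simps)

lemma co_eqI:
  assumes "\<And>i. i < 3 \<Longrightarrow> co i u = co i v" shows "u = v"
proof -
  have "co 0 u = co 0 v" "co 1 u = co 1 v" "co 2 u = co 2 v" using assms by auto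
  then have "a1 \<bullet> (u - v) = 0" "a2 \<bullet> (u - v) = 0"
    using co_roots[of u] co_roots[of v] by (auto simp: inner_diff_right)
  then show ?thesis using orthogonal_roots_imp_zero[of "u - v"] by simp
qed

lemma co_diff_scaleR: "co i (u - c *\<^sub>R v) = co i u - c * co i v"
  by (simp add: co_def inner_diff_right)

lemma co_on_roots: "co 0 a1 = 0" "co 1 a1 = -3" "co 2 a1 = 3" "co 0 a2 = 3" "co 1 a2 = 0" "co 2 a2 = -3"
  "co 0 (a1+a2) = 3" "co 1 (a1+a2) = -3" "co 2 (a1+a2) = 0"
  by (simp_all add: co_def inner_simps inner_add_left inner_add_right inner_diff_left)

lemma aff_refl_root:
  "aff_refl a1 k v = v - (a1 \<bullet> v - of_int k) *\<^sub>R a1"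
  "aff_refl a2 k v = v - (a2 \<bullet> v - of_int k) *\<^sub>R a2"
  "aff_refl (a1+a2) k v = v - ((a1+a2) \<bullet> v - of_int k) *\<^sub>R (a1+a2)"
proof -
  have "(a1+a2) \<bullet> (a1+a2) = 2" by (simp add: inner_simps inner_add_left inner_add_right)
  then show "aff_refl a1 k v = v - (a1 \<bullet> v - of_int k) *\<^sub>R a1"
    "aff_refl a2 k v = v - (a2 \<bullet> v - of_int k) *\<^sub>R a2"
    "aff_refl (a1+a2) k v = v - ((a1+a2) \<bullet> v - of_int k) *\<^sub>R (a1+a2)"
    unfolding aff_refl_def by (simp_all add: inner_simps)
qed

lemma co_refl_a1: "co 0 (aff_refl a1 k v) = co 0 v" "co 1 (aff_refl a1 k v) = co 2 v - 3*k" "co 2 (aff_refl a1 k v) = co 1 v + 3*k"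
  unfolding aff_refl_root co_diff_scaleR co_on_roots co_roots by (simp_all add: field_simps)

lemma co_refl_a2: "co 0 (aff_refl a2 k v) = co 2 v + 3*k" "co 1 (aff_refl a2 k v) = co 1 v" "co 2 (aff_refl a2 k v) = co 0 v - 3*k"
  unfolding aff_refl_root co_diff_scaleR co_on_roots co_roots by (simp_all add: field_simps)

lemma co_refl_a12: "co 0 (aff_refl (a1+a2) k v) = co 1 v + 3*k" "co 1 (aff_refl (a1+a2) k v) = co 0 v - 3*k" "co 2 (aff_refl (a1+a2) k v) = co 2 v"
  unfolding aff_refl_root co_diff_scaleR co_on_roots co_roots by (simp_all add: field_simps)

lemma less_3_cases: "i < (3::nat) \<Longrightarrow> i = 0 \<or> i = 1 \<or> i = 2" by auto

lemma aff_refl_uminus: "aff_refl (- \<alpha>) k = aff_refl (\<alpha>::'a) (- k)"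
proof
  fix v
  have "2 * ((- \<alpha>) \<bullet> v - of_int k) / ((- \<alpha>) \<bullet> (- \<alpha>)) = - (2 * (\<alpha> \<bullet> v - of_int (- k)) / (\<alpha> \<bullet> \<alpha>))"
    unfolding minus_divide_left by (simp add: algebra_simps)
  then show "aff_refl (- \<alpha>) k v = aff_refl \<alpha> (- k) v"
    unfolding aff_refl_def by (metis scaleR_minus_left scaleR_minus_right minus_minus)
qed

lemma reflections_cases:
  assumes "r \<in> reflections a1 a2"
  obtains k where "r = aff_refl a1 k" | k where "r = aff_refl a2 k" | k where "r = aff_refl (a1+a2) k"
proof -
  obtain \<alpha> k where r: "r = aff_refl \<alpha> k" "\<alpha> \<in> A2_roots a1 a2" using assms unfolding reflections_def by blast
  then show ?thesis using that aff_refl_uminus unfolding A2_roots_def by blast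
qed

lemma reflections_intros [simp]:
  "aff_refl a1 k \<in> reflections a1 a2" "aff_refl a2 k \<in> reflections a1 a2" "aff_refl (a1+a2) k \<in> reflections a1 a2"
  unfolding reflections_def A2_roots_def by auto

lemma refl_invol:
  assumes "r \<in> reflections a1 a2" shows "r (r v) = v"
  using assms
proof (cases rule: reflections_cases)
  case (1 k) show ?thesis unfolding 1 by (rule co_eqI) (auto dest!: less_3_cases simp: co_refl_a1 simp del: One_nat_def)
next
  case (2 k) show ?thesis unfolding 2 by (rule co_eqI) (auto dest!: less_3_cases simp: co_refl_a2 simp del: One_nat_def)
next
  case (3 k) show ?thesis unfolding 3 by (rule co_eqI) (auto dest!: less_3_cases simp: co_refl_a12 simp del: One_nat_def)
qed

lemma reflection_Bij: assumes "r \<in> reflections a1 a2" shows "r \<in> Bij UNIV"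
proof -
  have "r \<circ> r = id" using refl_invol[OF assms] by (simp add: fun_eq_iff)
  then have "bij r" using o_bij by blast
  then show ?thesis by (simp add: Bij_def)
qed

lemma BijGroup_mult: "u \<in> Bij UNIV \<Longrightarrow> v \<in> Bij UNIV \<Longrightarrow> u \<otimes>\<^bsub>BijGroup UNIV\<^esub> v = u \<circ> (v :: 'a \<Rightarrow> 'a)"
  by (simp add: BijGroup_def compose_def fun_eq_iff)

lemma BijGroup_one: "\<one>\<^bsub>BijGroup UNIV\<^esub> = (id :: 'a \<Rightarrow> 'a)"
  by (simp add: BijGroup_def fun_eq_iff)

lemma weyl_Bij:
  assumes "w \<in> affine_weyl a1 a2" shows "w \<in> Bij UNIV"
proof -
  interpret G: group "BijGroup (UNIV :: 'a set)" by (rule group_BijGroup)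
  have c: "carrier (BijGroup UNIV) = (Bij UNIV :: ('a \<Rightarrow> 'a) set)" by (simp add: BijGroup_def)
  have "reflections a1 a2 \<subseteq> carrier (BijGroup UNIV)" unfolding c using reflection_Bij by blast
  from G.generate_in_carrier[OF this] assms show ?thesis unfolding affine_weyl_def c by blast
qed

lemma foldr_comp_Cons: "foldr (\<circ>) (f # fs) id = f \<circ> foldr (\<circ>) fs id"
  by simp

lemma foldr_comp_append: "foldr (\<circ>) (xs @ ys) id = foldr (\<circ>) xs id \<circ> foldr (\<circ>) ys id"
  by (induction xs) (simp_all add: comp_assoc)

text \<open>Reflections are involutions, so inverses of generators contribute nothing new and words
  in reflections suffice.\<close>

lemma affine_weyl_eq:
  "affine_weyl a1 a2 = {foldr (\<circ>) rs id | rs. set rs \<subseteq> reflections a1 a2}" (is "_ = ?R")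
proof
  show "affine_weyl a1 a2 \<subseteq> ?R"
  proof
    fix w assume "w \<in> affine_weyl a1 a2"
    then show "w \<in> ?R" unfolding affine_weyl_def
    proof (induction rule: generate.induct)
      case one
      have "set [] \<subseteq> reflections a1 a2" "\<one>\<^bsub>BijGroup UNIV\<^esub> = foldr (\<circ>) [] (id :: 'a \<Rightarrow> 'a)"
        unfolding BijGroup_one by simp_all
      then show ?case by blast
    next
      case (incl h)
      then have "set [h] \<subseteq> reflections a1 a2" "h = foldr (\<circ>) [h] id" by simp_all
      then show ?case by blast
    next
      case (inv h)
      have "inv_into UNIV h v = h v" for v
        using refl_invol[OF inv] by (metis UNIV_I f_inv_into_f range_eqI)
      then have "inv\<^bsub>BijGroup UNIV\<^esub> h = h"
        unfolding inv_BijGroup[OF reflection_Bij[OF inv]] by (simp add: fun_eq_iff)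
      with inv have "set [h] \<subseteq> reflections a1 a2" "inv\<^bsub>BijGroup UNIV\<^esub> h = foldr (\<circ>) [h] id" by simp_all
      then show ?case by blast
    next
      case (eng h1 h2)
      then obtain rs rs' where r: "h1 = foldr (\<circ>) rs id" "h2 = foldr (\<circ>) rs' id" "set rs \<subseteq> reflections a1 a2" "set rs' \<subseteq> reflections a1 a2" by blast
      have "h1 \<otimes>\<^bsub>BijGroup UNIV\<^esub> h2 = h1 \<circ> h2"
        using BijGroup_mult weyl_Bij eng(1,2) unfolding affine_weyl_def by blast
      then have "h1 \<otimes>\<^bsub>BijGroup UNIV\<^esub> h2 = foldr (\<circ>) (rs @ rs') id" unfolding foldr_comp_append r .
      moreover have "set (rs @ rs') \<subseteq> reflections a1 a2" using r by simp
      ultimately show ?case by blast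
    qed
  qed
  have "foldr (\<circ>) rs id \<in> affine_weyl a1 a2" if "set rs \<subseteq> reflections a1 a2" for rs
    using that
  proof (induction rs)
    case Nil
    have "foldr (\<circ>) [] id = (id :: 'a \<Rightarrow> 'a)" by simp
    then show ?case using generate.one[of "BijGroup UNIV" "reflections a1 a2"] unfolding affine_weyl_def BijGroup_one by metis
  next
    case (Cons r rs)
    from Cons.prems have p: "set rs \<subseteq> reflections a1 a2" "r \<in> reflections a1 a2" by simp_all
    have h: "foldr (\<circ>) rs id \<in> affine_weyl a1 a2" "r \<in> affine_weyl a1 a2"
      by (rule Cons.IH[OF p(1)], unfold affine_weyl_def, rule generate.incl[OF p(2)])
    have "r \<otimes>\<^bsub>BijGroup UNIV\<^esub> foldr (\<circ>) rs id \<in> affine_weyl a1 a2"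
      using generate.eng[OF h(2,1)[unfolded affine_weyl_def]] unfolding affine_weyl_def .
    then show ?case unfolding BijGroup_mult[OF weyl_Bij[OF h(2)] weyl_Bij[OF h(1)]] foldr_comp_Cons .
  qed
  then show "?R \<subseteq> affine_weyl a1 a2" by blast
qed

lemma id_weyl [simp]: "id \<in> affine_weyl a1 a2"
proof -
  have "set [] \<subseteq> reflections a1 a2" "id = foldr (\<circ>) [] (id :: 'a \<Rightarrow> 'a)" by simp_all
  then show ?thesis unfolding affine_weyl_eq by blast
qed

lemma refl_comp_weyl [simp]:
  assumes r: "r \<in> reflections a1 a2" and w: "w \<in> affine_weyl a1 a2"
  shows "r \<circ> w \<in> affine_weyl a1 a2"
proof -
  from w obtain rs where "set rs \<subseteq> reflections a1 a2" "w = foldr (\<circ>) rs id" unfolding affine_weyl_eq by blast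
  then have "set (r # rs) \<subseteq> reflections a1 a2" "r \<circ> w = foldr (\<circ>) (r # rs) id" using r by auto
  then show ?thesis unfolding affine_weyl_eq by blast
qed

lemma weyl_induct [consumes 1, case_names id refl]:
  assumes "w \<in> affine_weyl a1 a2" "P id"
    "\<And>r w. r \<in> reflections a1 a2 \<Longrightarrow> w \<in> affine_weyl a1 a2 \<Longrightarrow> P w \<Longrightarrow> P (r \<circ> w)"
  shows "P w"
proof -
  obtain rs where "set rs \<subseteq> reflections a1 a2" "w = foldr (\<circ>) rs id" using assms(1) unfolding affine_weyl_eq by auto
  then show ?thesis
  proof (induction rs arbitrary: w)
    case Nil
    then have "w = id" by (simp add: id_def)
    then show ?case using assms(2) by metis
  next
    case (Cons r rs)
    have p: "set rs \<subseteq> reflections a1 a2" "r \<in> reflections a1 a2" using Cons.prems(1) by simp_all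
    then have "foldr (\<circ>) rs id \<in> affine_weyl a1 a2" unfolding affine_weyl_eq by blast
    moreover have "w = r \<circ> foldr (\<circ>) rs id" using Cons.prems(2) unfolding foldr_comp_Cons .
    ultimately show ?case using assms(3)[OF p(2)] Cons.IH[OF p(1) refl] by blast
  qed
qed

section \<open>From group elements to integer coordinates\<close>

definition centroid :: 'a where "centroid = (1/3) *\<^sub>R (a1 + a2)"

lemma co_centroid: "co 0 centroid = 1" "co 1 centroid = -1" "co 2 centroid = 0"
proof -
  have "co i centroid = (1/3) * co i (a1+a2)" for i by (simp add: co_def centroid_def)
  from this[of 0] this[of 1] this[of 2]
  show "co 0 centroid = 1" "co 1 centroid = -1" "co 2 centroid = 0" by (simp_all only: co_on_roots)
qed

text \<open>On the affine Weyl group the coordinates of the image are integers already; the floors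
  only convert the type. The shifts by 1 place the fundamental alcove at the origin.\<close>

definition pos :: "('a \<Rightarrow> 'a) \<Rightarrow> coords" where
  "pos w = (\<lfloor>co 0 (w centroid)\<rfloor> - 1, \<lfloor>co 1 (w centroid)\<rfloor> + 1, \<lfloor>co 2 (w centroid)\<rfloor>)"

lemma pos_id: "pos id = (0,0,0)"
proof -
  have "\<lfloor>-1::real\<rfloor> = -1" by linarith
  then show ?thesis by (simp add: pos_def co_centroid del: One_nat_def)
qed

lemma floor_3: "\<lfloor>x + real_of_int (3*k)\<rfloor> = \<lfloor>x\<rfloor> + 3*k" "\<lfloor>x - real_of_int (3*k)\<rfloor> = \<lfloor>x\<rfloor> - 3*k"
  by linarith+

text \<open>The third index is reversed because the third strip function is 1 - \<alpha>1 -
  \<alpha>2, whose level 1-k is the line \<alpha>1 + \<alpha>2 = k.\<close>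

lemma pos_refl:
  "pos (aff_refl a1 k \<circ> w) = refl0 k (pos w)"
  "pos (aff_refl a2 k \<circ> w) = refl1 k (pos w)"
  "pos (aff_refl (a1+a2) k \<circ> w) = refl2 (1-k) (pos w)"
  unfolding pos_def comp_apply co_refl_a1 co_refl_a2 co_refl_a12 floor_3 by simp_all

lemma pos_s0: "pos (aff_refl (a1+a2) 1 \<circ> w) = refl2 0 (pos w)"
  using pos_refl(3)[of 1 w] by (simp only: diff_self)

lemma reflected_pos:
  assumes "r \<in> reflections a1 a2" shows "reflected (pos w) (pos (r \<circ> w))"
  using assms by (cases rule: reflections_cases) (auto simp: reflected_def pos_refl)

lemma reflected_pos_ex:
  assumes "reflected (pos w) q" obtains r where "r \<in> reflections a1 a2" "pos (r \<circ> w) = q"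
proof -
  from assms obtain k where "q = refl0 k (pos w) \<or> q = refl1 k (pos w) \<or> q = refl2 k (pos w)" unfolding reflected_def by blast
  then show ?thesis
  proof (elim disjE)
    assume "q = refl0 k (pos w)" then show ?thesis using that[of "aff_refl a1 k"] pos_refl by simp
  next
    assume "q = refl1 k (pos w)" then show ?thesis using that[of "aff_refl a2 k"] pos_refl by simp
  next
    assume "q = refl2 k (pos w)" then show ?thesis using that[of "aff_refl (a1+a2) (1-k)"] pos_refl by simp
  qed
qed

lemma alcove_pos: "w \<in> affine_weyl a1 a2 \<Longrightarrow> alcove (pos w)"
proof (induction rule: weyl_induct)
  case id
  show ?case unfolding pos_id by simp
next
  case (refl r w)
  then show ?case using alcove_reflected[OF reflected_pos[OF refl(1)]] by blast
qed

text \<open>In the coordinates \<open>co\<close>, elements of \<open>W\<close> permute the coordinates and translate them by multiples of \<open>3\<close>.\<close>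

definition aperm :: "('a \<Rightarrow> 'a) \<Rightarrow> (nat \<Rightarrow> nat) \<Rightarrow> (nat \<Rightarrow> int) \<Rightarrow> bool" where
  "aperm w \<pi> m \<longleftrightarrow> \<pi> ` {..<3} \<subseteq> {..<3} \<and> inj_on \<pi> {..<3} \<and> (\<forall>v. \<forall>i<3. co i (w v) = co (\<pi> i) v + 3 * of_int (m i))"

lemma aperm_comp:
  assumes "aperm u \<pi> m" "aperm w \<rho> n" shows "aperm (u \<circ> w) (\<rho> \<circ> \<pi>) (\<lambda>i. n (\<pi> i) + m i)"
proof -
  have p: "\<pi> i < 3" if "i < 3" for i using assms(1) that unfolding aperm_def by auto
  have "inj_on (\<rho> \<circ> \<pi>) {..<3}"
    using assms unfolding aperm_def by (intro comp_inj_on) (auto intro: inj_on_subset)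
  moreover have "(\<rho> \<circ> \<pi>) ` {..<3} \<subseteq> {..<3}" using assms unfolding aperm_def by fastforce
  moreover have "co i ((u \<circ> w) v) = co ((\<rho> \<circ> \<pi>) i) v + 3 * of_int (n (\<pi> i) + m i)" if "i < 3" for v i
    using assms p[OF that] that unfolding aperm_def by simp
  ultimately show ?thesis unfolding aperm_def by blast
qed

lemma aperm_refl:
  assumes "r \<in> reflections a1 a2" obtains \<pi> m where "aperm r \<pi> m"
  using assms
proof (cases rule: reflections_cases)
  case (1 k)
  have "aperm r (id(1 := 2, 2 := 1)) ((\<lambda>_. 0)(1 := -k, 2 := k))"
    unfolding aperm_def 1 by (auto dest!: less_3_cases simp: co_refl_a1 inj_on_def simp del: One_nat_def)
  then show ?thesis by (rule that)
next
  case (2 k)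
  have "aperm r (id(0 := 2, 2 := 0)) ((\<lambda>_. 0)(0 := k, 2 := -k))"
    unfolding aperm_def 2 by (auto dest!: less_3_cases simp: co_refl_a2 inj_on_def simp del: One_nat_def)
  then show ?thesis by (rule that)
next
  case (3 k)
  have "aperm r (id(0 := 1, 1 := 0)) ((\<lambda>_. 0)(0 := k, 1 := -k))"
    unfolding aperm_def 3 by (auto dest!: less_3_cases simp: co_refl_a12 inj_on_def simp del: One_nat_def)
  then show ?thesis by (rule that)
qed

lemma aperm_ex:
  assumes "w \<in> affine_weyl a1 a2" shows "\<exists>\<pi> m. aperm w \<pi> m"
  using assms
proof (induction rule: weyl_induct)
  case id
  have "aperm id id (\<lambda>_. 0)" by (auto simp: aperm_def)
  then show ?case by blast
next
  case (refl r w)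
  then show ?case using aperm_refl[of r] aperm_comp by metis
qed

definition centroid_int :: "nat \<Rightarrow> int" where "centroid_int i = (if i = 0 then 1 else if i = 1 then -1 else 0)"

lemma co_centroid_int: "i < 3 \<Longrightarrow> co i centroid = of_int (centroid_int i)"
  by (auto dest!: less_3_cases simp: co_centroid centroid_int_def simp del: One_nat_def)

text \<open>The centroid has coordinates 1, -1, 0, which are distinct modulo 3. Residues of the
  image thus reveal the permutation, and then the quotients reveal the translation.\<close>

lemma pos_inj:
  assumes "u \<in> affine_weyl a1 a2" "w \<in> affine_weyl a1 a2" "pos u = pos w"
  shows "u = w"
proof -
  obtain \<pi> m \<rho> n where u: "aperm u \<pi> m" and w: "aperm w \<rho> n" using aperm_ex assms by blast
  have p: "\<pi> i < 3" "\<rho> i < 3" if "i < 3" for i using u w that unfolding aperm_def by auto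
  have cu: "co i (u centroid) = of_int (centroid_int (\<pi> i) + 3 * m i)" if "i < 3" for i
    using u that p[OF that] co_centroid_int unfolding aperm_def by simp
  have cw: "co i (w centroid) = of_int (centroid_int (\<rho> i) + 3 * n i)" if "i < 3" for i
    using w that p[OF that] co_centroid_int unfolding aperm_def by simp
  have fe: "\<lfloor>co i (u centroid)\<rfloor> = \<lfloor>co i (w centroid)\<rfloor>" if "i < 3" for i
    using less_3_cases[OF that] assms(3) unfolding pos_def by auto
  have e: "centroid_int (\<pi> i) + 3 * m i = centroid_int (\<rho> i) + 3 * n i" if "i < 3" for i
    using fe[OF that] unfolding cu[OF that] cw[OF that] floor_of_int .
  have "\<pi> i = \<rho> i \<and> m i = n i" if "i < 3" for i
  proof -
    have "\<pi> i = \<rho> i" using e[OF that] less_3_cases[OF p(1)[OF that]] less_3_cases[OF p(2)[OF that]]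
      unfolding centroid_int_def by (elim disjE; simp; presburger)
    then show ?thesis using e[OF that] by simp
  qed
  then have "co i (u v) = co i (w v)" if "i < 3" for i v using u w that unfolding aperm_def by simp
  then show ?thesis by (intro ext co_eqI)
qed

section \<open>Length equals height\<close>

lemma simple_reflections_weyl: "simple_reflections a1 a2 \<subseteq> reflections a1 a2"
  unfolding simple_reflections_def by auto

lemma height_pos_word:
  "set ss \<subseteq> simple_reflections a1 a2 \<Longrightarrow>
    foldr (\<circ>) ss id \<in> affine_weyl a1 a2 \<and> height (pos (foldr (\<circ>) ss id)) \<le> int (length ss)"
proof (induction ss)
  case Nil
  have "foldr (\<circ>) [] id = (id :: 'a \<Rightarrow> 'a)" by simp
  moreover have "height (0,0,0) = 0" by (simp add: height.simps)
  ultimately show ?case using pos_id id_weyl by (metis list.size(3) of_nat_0 order_refl)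
next
  case (Cons s ss)
  let ?w = "foldr (\<circ>) ss id"
  from Cons.prems have "set ss \<subseteq> simple_reflections a1 a2" by simp
  note w = conjunct1[OF Cons.IH[OF this]] conjunct2[OF Cons.IH[OF this]]
  have s: "s = aff_refl a1 0 \<or> s = aff_refl a2 0 \<or> s = aff_refl (a1+a2) 1" using Cons.prems unfolding simple_reflections_def by auto
  have "height (pos (s \<circ> ?w)) \<le> height (pos ?w) + 1"
  proof -
    have "height (pos (aff_refl a1 0 \<circ> ?w)) \<le> height (pos ?w) + 1" "height (pos (aff_refl a2 0 \<circ> ?w)) \<le> height (pos ?w) + 1"
      "height (pos (aff_refl (a1+a2) 1 \<circ> ?w)) \<le> height (pos ?w) + 1"
      unfolding pos_refl(1,2) pos_s0 by (rule height_simple_le[OF alcove_pos[OF w(1)]])+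
    then show ?thesis using s by metis
  qed
  moreover have "s \<circ> ?w \<in> affine_weyl a1 a2" using refl_comp_weyl[OF _ w(1)] s reflections_intros by metis
  moreover have "int (length (s # ss)) = int (length ss) + 1" by simp
  ultimately show ?case using w(2) unfolding foldr_comp_Cons by (intro conjI; linarith)
qed

lemma word_exists:
  assumes "w \<in> affine_weyl a1 a2" "height (pos w) = int n"
  shows "\<exists>ss. set ss \<subseteq> simple_reflections a1 a2 \<and> length ss = n \<and> w = foldr (\<circ>) ss id"
  using assms
proof (induction n arbitrary: w)
  case 0
  have "pos w = (0,0,0)"
  proof (rule ccontr)
    assume "pos w \<noteq> (0,0,0)"
    then have "height (refl0 0 (pos w)) = -1 \<or> height (refl1 0 (pos w)) = -1 \<or> height (refl2 0 (pos w)) = -1"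
      using height_descent[OF alcove_pos[OF 0(1)]] 0(2) by simp
    moreover have "height p \<ge> 0" for p by (cases p) (simp add: height.simps)
    ultimately show False by (metis neg_0_le_iff_le not_one_le_zero)
  qed
  then have "w = id" using pos_inj[OF 0(1) id_weyl] pos_id by simp
  then show ?case by (intro exI[of _ "[]"]) simp
next
  case (Suc n)
  have "pos w \<noteq> (0,0,0)" using Suc(3) by (auto simp: height.simps)
  then obtain s where s: "s \<in> simple_reflections a1 a2" "height (pos (s \<circ> w)) = int n"
  proof -
    have m: "aff_refl a1 0 \<in> simple_reflections a1 a2" "aff_refl a2 0 \<in> simple_reflections a1 a2"
      "aff_refl (a1+a2) 1 \<in> simple_reflections a1 a2" unfolding simple_reflections_def by auto
    have h: "height (pos w) - 1 = int n" using Suc(3) by simp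
    from height_descent[OF alcove_pos[OF Suc(2)] \<open>pos w \<noteq> (0,0,0)\<close>] show thesis unfolding h
      using that m pos_refl(1,2)[of 0 w] pos_s0[of w] by metis
  qed
  have r: "s \<in> reflections a1 a2" using s simple_reflections_weyl by blast
  then obtain ss where ss: "set ss \<subseteq> simple_reflections a1 a2" "length ss = n" "s \<circ> w = foldr (\<circ>) ss id"
    using Suc(1)[OF _ s(2)] Suc(2) refl_comp_weyl by blast
  have "w = s \<circ> (s \<circ> w)" using refl_invol[OF r] by (simp add: fun_eq_iff)
  then have "w = foldr (\<circ>) (s # ss) id" unfolding ss(3) foldr_comp_Cons .
  moreover have "set (s # ss) \<subseteq> simple_reflections a1 a2" "length (s # ss) = Suc n" using ss s by simp_all
  ultimately show ?case by blast
qed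

lemma weyl_length_eq:
  assumes "w \<in> affine_weyl a1 a2" shows "int (weyl_length a1 a2 w) = height (pos w)"
proof -
  have "height (pos w) \<ge> 0" by (cases "pos w") (simp add: height.simps)
  then obtain n where n: "height (pos w) = int n" using nonneg_int_cases by blast
  have "weyl_length a1 a2 w = n"
    unfolding weyl_length_def
  proof (rule Least_equality)
    show "\<exists>ss. set ss \<subseteq> simple_reflections a1 a2 \<and> length ss = n \<and> w = foldr (\<circ>) ss id"
      by (rule word_exists[OF assms n])
  next
    fix k assume "\<exists>ss. set ss \<subseteq> simple_reflections a1 a2 \<and> length ss = k \<and> w = foldr (\<circ>) ss id"
    then show "n \<le> k" using height_pos_word n by fastforce
  qed
  then show ?thesis using n by simp
qed

text \<open>No line of the arrangement crosses an alcove: on the open fundamental alcove a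
  difference of two coordinates keeps the sign it has at the centroid and stays below 3 in absolute
  value. The bounds at the centroid then leave one possible translation \<open>d\<close>, 0 or 1
  according to this sign.\<close>

lemma strip_bounds:
  assumes w: "w \<in> affine_weyl a1 a2" and ij: "i < 3" "j < 3" "i \<noteq> j"
    and c: "0 \<le> \<lfloor>co j (w centroid)\<rfloor> - \<lfloor>co i (w centroid)\<rfloor>" "\<lfloor>co j (w centroid)\<rfloor> - \<lfloor>co i (w centroid)\<rfloor> \<le> 3"
    and v: "v \<in> fund_alcove a1 a2"
  shows "0 \<le> co j (w v) - co i (w v)" "co j (w v) - co i (w v) \<le> 3"
proof -
  obtain \<pi> m where p: "aperm w \<pi> m" using aperm_ex[OF w] by blast
  have lt: "\<pi> i < 3" "\<pi> j < 3" using p ij unfolding aperm_def by auto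
  have ne: "\<pi> i \<noteq> \<pi> j" using p ij unfolding aperm_def inj_on_def by auto
  have co: "co i (w u) = co (\<pi> i) u + 3 * of_int (m i)" "co j (w u) = co (\<pi> j) u + 3 * of_int (m j)" for u
    using p ij unfolding aperm_def by auto
  have floors: "\<lfloor>co i (w centroid)\<rfloor> = centroid_int (\<pi> i) + 3 * m i" "\<lfloor>co j (w centroid)\<rfloor> = centroid_int (\<pi> j) + 3 * m j"
    unfolding co co_centroid_int[OF lt(1)] co_centroid_int[OF lt(2)] by linarith+
  have a: "0 < co 2 v - co 1 v" "0 < co 0 v - co 2 v" "co 0 v - co 1 v < 3"
    using v co_roots[of v] unfolding fund_alcove_def by (auto simp: inner_commute)
  define d where "d = m j - m i"
  have D: "co j (w v) - co i (w v) = co (\<pi> j) v - co (\<pi> i) v + 3 * of_int d" unfolding co d_def by simp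
  have C: "0 \<le> centroid_int (\<pi> j) - centroid_int (\<pi> i) + 3 * d" "centroid_int (\<pi> j) - centroid_int (\<pi> i) + 3 * d \<le> 3"
    using c unfolding floors d_def by simp_all
  consider "centroid_int (\<pi> j) > centroid_int (\<pi> i)" "0 < co (\<pi> j) v - co (\<pi> i) v" "co (\<pi> j) v - co (\<pi> i) v < 3"
       "centroid_int (\<pi> j) - centroid_int (\<pi> i) \<le> 2"
    | "centroid_int (\<pi> j) < centroid_int (\<pi> i)" "0 > co (\<pi> j) v - co (\<pi> i) v" "co (\<pi> j) v - co (\<pi> i) v > -3"
       "centroid_int (\<pi> j) - centroid_int (\<pi> i) \<ge> -2"
  proof -
    have "(centroid_int (\<pi> j) > centroid_int (\<pi> i) \<and> 0 < co (\<pi> j) v - co (\<pi> i) v \<and> co (\<pi> j) v - co (\<pi> i) v < 3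
       \<and> centroid_int (\<pi> j) - centroid_int (\<pi> i) \<le> 2)
    \<or> (centroid_int (\<pi> j) < centroid_int (\<pi> i) \<and> 0 > co (\<pi> j) v - co (\<pi> i) v \<and> co (\<pi> j) v - co (\<pi> i) v > -3
       \<and> centroid_int (\<pi> j) - centroid_int (\<pi> i) \<ge> -2)"
      using less_3_cases[OF lt(1)] less_3_cases[OF lt(2)] ne a
      by (elim disjE; simp add: centroid_int_def del: One_nat_def)
    then show thesis using that by blast
  qed
  then have "0 \<le> co j (w v) - co i (w v) \<and> co j (w v) - co i (w v) \<le> 3"
  proof cases
    case 1
    then have "d = 0" using C by linarith
    then show ?thesis using 1 D by simp
  next
    case 2
    then have "d = 1" using C by linarith
    then show ?thesis using 2 D by simp
  qed
  then show "0 \<le> co j (w v) - co i (w v)" "co j (w v) - co i (w v) \<le> 3" by auto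
qed

lemma nonspiral_strips:
  assumes w: "w \<in> affine_weyl a1 a2" "\<not> spiral a1 a2 w" and p: "pos w = (x,y,z)"
  shows "(1+z-y) div 3 \<noteq> 0" "(1+x-z) div 3 \<noteq> 0" "(1+y-x) div 3 \<noteq> 0"
proof -
  have e: "x = \<lfloor>co 0 (w centroid)\<rfloor> - 1" "y = \<lfloor>co 1 (w centroid)\<rfloor> + 1" "z = \<lfloor>co 2 (w centroid)\<rfloor>" using p unfolding pos_def by auto
  have ns: "\<exists>v\<in>fund_alcove a1 a2. \<not> (0 \<le> \<alpha> \<bullet> w v \<and> \<alpha> \<bullet> w v \<le> 1)" if "\<alpha> \<in> {a1, a2, a1 + a2}" for \<alpha>
    using w(2) that unfolding spiral_def by blast
  have z3: "0 \<le> t \<and> t \<le> 2" if "t div 3 = 0" for t :: int using that by presburger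
  show "(1+z-y) div 3 \<noteq> 0"
  proof
    assume "(1+z-y) div 3 = 0"
    then have "0 \<le> \<lfloor>co 2 (w centroid)\<rfloor> - \<lfloor>co 1 (w centroid)\<rfloor>" "\<lfloor>co 2 (w centroid)\<rfloor> - \<lfloor>co 1 (w centroid)\<rfloor> \<le> 3"
      using z3[of "1+z-y"] e by linarith+
    from strip_bounds[OF w(1) _ _ _ this] have "0 \<le> a1 \<bullet> w v \<and> a1 \<bullet> w v \<le> 1" if "v \<in> fund_alcove a1 a2" for v
      using that unfolding co_roots by simp
    then show False using ns[of a1] by blast
  qed
  show "(1+x-z) div 3 \<noteq> 0"
  proof
    assume "(1+x-z) div 3 = 0"
    then have "0 \<le> \<lfloor>co 0 (w centroid)\<rfloor> - \<lfloor>co 2 (w centroid)\<rfloor>" "\<lfloor>co 0 (w centroid)\<rfloor> - \<lfloor>co 2 (w centroid)\<rfloor> \<le> 3"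
      using z3[of "1+x-z"] e by linarith+
    from strip_bounds[OF w(1) _ _ _ this] have "0 \<le> a2 \<bullet> w v \<and> a2 \<bullet> w v \<le> 1" if "v \<in> fund_alcove a1 a2" for v
      using that unfolding co_roots by simp
    then show False using ns[of a2] by blast
  qed
  show "(1+y-x) div 3 \<noteq> 0"
  proof
    assume "(1+y-x) div 3 = 0"
    \<comment> \<open>The third strip is measured by the complement: \<open>1+y-x\<close> is 3 minus
      this difference, which therefore ranges over 1 to 3 instead of 0 to 2. This is why the bound
      is 3 throughout.\<close>
    then have "0 \<le> \<lfloor>co 0 (w centroid)\<rfloor> - \<lfloor>co 1 (w centroid)\<rfloor>" "\<lfloor>co 0 (w centroid)\<rfloor> - \<lfloor>co 1 (w centroid)\<rfloor> \<le> 3"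
      using z3[of "1+y-x"] e by linarith+
    from strip_bounds[OF w(1) _ _ _ this] have "0 \<le> (a1+a2) \<bullet> w v \<and> (a1+a2) \<bullet> w v \<le> 1" if "v \<in> fund_alcove a1 a2" for v
      using that unfolding co_roots by simp
    then show False using ns[of "a1+a2"] by blast
  qed
qed

section \<open>Bruhat intervals and reflection counts from certificates\<close>

lemma bruhat_step_pos:
  assumes "bruhat_step a1 a2 u v" "u \<in> affine_weyl a1 a2"
  shows "v \<in> affine_weyl a1 a2" "reflected (pos v) (pos u)" "height (pos u) < height (pos v)"
proof -
  obtain r where r: "r \<in> reflections a1 a2" "v = r \<circ> u" "weyl_length a1 a2 u < weyl_length a1 a2 v"
    using assms(1) unfolding bruhat_step_def by blast
  show v: "v \<in> affine_weyl a1 a2" unfolding r(2) using r(1) assms(2) by (rule refl_comp_weyl)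
  have "u = r \<circ> v" using refl_invol[OF r(1)] unfolding r(2) by (simp add: fun_eq_iff)
  then show "reflected (pos v) (pos u)" using reflected_pos[OF r(1), of v] by metis
  show "height (pos u) < height (pos v)" using r(3) weyl_length_eq[OF v] weyl_length_eq[OF assms(2)] by linarith
qed

lemma bruhat_le_induct:
  assumes "bruhat_le a1 a2 u w" "P (pos w)"
    and step: "\<And>p q. alcove p \<Longrightarrow> P p \<Longrightarrow> reflected p q \<Longrightarrow> height q < height p \<Longrightarrow> P q"
  shows "P (pos u)"
proof -
  have "(bruhat_step a1 a2)\<^sup>*\<^sup>* u w" "u \<in> affine_weyl a1 a2" using assms(1) unfolding bruhat_le_def by auto
  then show ?thesis
  proof (induction rule: converse_rtranclp_induct)
    case base
    show ?case by (rule assms(2))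
  next
    case (step u v)
    note b = bruhat_step_pos[OF step.hyps(1) step.prems]
    show ?case by (rule assms(3)[OF alcove_pos[OF b(1)] step.IH[OF b(1)] b(2,3)])
  qed
qed

text \<open>Closure under shortening reflections gives one direction. For the other, climb from
  \<open>u\<close> inside \<open>S\<close>: the height bound ends the climb, and the only point
  where it can end is \<open>w\<close>.\<close>

lemma bruhat_le_iff_certificate:
  assumes w: "w \<in> affine_weyl a1 a2" and S: "certificate (pos w) S" and u: "u \<in> affine_weyl a1 a2"
  shows "bruhat_le a1 a2 u w \<longleftrightarrow> S (pos u)"
proof
  note c = S[unfolded certificate_def]
  note c1 = conjunct1[OF c] and c2 = conjunct1[OF conjunct2[OF c], rule_format]
    and c3 = conjunct1[OF conjunct2[OF conjunct2[OF c]], rule_format]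
    and c4 = conjunct1[OF conjunct2[OF conjunct2[OF conjunct2[OF c]]]]
  {
    assume "bruhat_le a1 a2 u w"
    then show "S (pos u)" by (rule bruhat_le_induct) (use c1 c2 in blast)+
  next
    obtain C where C: "\<And>p. S p \<Longrightarrow> height p \<le> C" using c4 by blast
    assume "S (pos u)"
    with u have "(bruhat_step a1 a2)\<^sup>*\<^sup>* u w"
    proof (induction "nat (C - height (pos u))" arbitrary: u rule: less_induct)
      case less
      show ?case
      proof (cases "u = w")
        case False
        then have "pos u \<noteq> pos w" using pos_inj[OF less.prems(1) w] by blast
        then obtain q where q: "reflected (pos u) q" "height (pos u) < height q" "S q"
          using c3[of "pos u"] alcove_pos[OF less.prems(1)] less.prems(2) by blast
        obtain r where r: "r \<in> reflections a1 a2" "pos (r \<circ> u) = q" using reflected_pos_ex[OF q(1)] by blast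
        have v: "r \<circ> u \<in> affine_weyl a1 a2" using r(1) less.prems(1) by (rule refl_comp_weyl)
        have "weyl_length a1 a2 u < weyl_length a1 a2 (r \<circ> u)"
          using weyl_length_eq[OF v] weyl_length_eq[OF less.prems(1)] q(2) unfolding r(2) by linarith
        then have "bruhat_step a1 a2 u (r \<circ> u)" unfolding bruhat_step_def using r(1) by blast
        moreover have "nat (C - height (pos (r \<circ> u))) < nat (C - height (pos u))"
          using C[OF q(3)] q(2) unfolding r(2) by linarith
        then have "(bruhat_step a1 a2)\<^sup>*\<^sup>* (r \<circ> u) w"
          using less.hyps[OF _ v] q(3) unfolding r(2) by blast
        ultimately show ?thesis by (rule converse_rtranclp_into_rtranclp)
      qed simp
    qed
    then show "bruhat_le a1 a2 u w" using u w unfolding bruhat_le_def by blast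
  }
qed

lemma refl_count_certificate:
  assumes w: "w \<in> affine_weyl a1 a2" and S: "certificate (pos w) S" and x: "x \<in> affine_weyl a1 a2"
  shows "int (refl_count a1 a2 w x) = refl_total S (pos x)"
proof -
  obtain C where C: "\<And>p. S p \<Longrightarrow> height p \<le> C" using S unfolding certificate_def by blast
  let ?K0 = "{k. S (refl0 k (pos x))}" and ?K1 = "{k. S (refl1 k (pos x))}" and ?K2 = "{k. S (refl2 k (pos x))}"
  have fin: "finite ?K0" "finite ?K1" "finite ?K2"
    by (rule finite_subset[OF _ finite_height_refl(1)[of "pos x" C]], use C in blast)
      (rule finite_subset[OF _ finite_height_refl(2)[of "pos x" C]], use C in blast,
       rule finite_subset[OF _ finite_height_refl(3)[of "pos x" C]], use C in blast)
  let ?f0 = "\<lambda>k. aff_refl a1 k" and ?f1 = "\<lambda>k. aff_refl a2 k" and ?f2 = "\<lambda>k. aff_refl (a1+a2) (1-k)"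
  have inj: "inj ?f0" "inj ?f1" "inj ?f2"
  proof -
    have "k = l" if "aff_refl a1 k = aff_refl a1 l" for k l
      using arg_cong[OF that, of "\<lambda>r. co 1 (r 0)"] unfolding co_refl_a1 by linarith
    then show "inj ?f0" by (rule injI)
    have "k = l" if "aff_refl a2 k = aff_refl a2 l" for k l
      using arg_cong[OF that, of "\<lambda>r. co 2 (r 0)"] unfolding co_refl_a2 by linarith
    then show "inj ?f1" by (rule injI)
    have "k = l" if "aff_refl (a1+a2) (1-k) = aff_refl (a1+a2) (1-l)" for k l
      using arg_cong[OF that, of "\<lambda>r. co 0 (r 0)"] unfolding co_refl_a12 by simp
    then show "inj ?f2" by (rule injI)
  qed
  have n3: "real_of_int (3*k) \<noteq> 1" "real_of_int (3*k) \<noteq> 2" for k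
  proof -
    have "3*k \<noteq> 1" "3*k \<noteq> 2" by presburger+
    then show "real_of_int (3*k) \<noteq> 1" "real_of_int (3*k) \<noteq> 2"
      unfolding of_int_eq_1_iff of_int_eq_numeral_iff .
  qed
  \<comment> \<open>Reflections in different directions permute the residues 1, -1, 0 of the
    centroid differently, so one coordinate modulo 3 tells them apart.\<close>
  have ne: "aff_refl a1 k \<noteq> aff_refl a2 l" "aff_refl a1 k \<noteq> aff_refl (a1+a2) l" "aff_refl a2 k \<noteq> aff_refl (a1+a2) l" for k l
  proof -
    show "aff_refl a1 k \<noteq> aff_refl a2 l"
    proof
      assume "aff_refl a1 k = aff_refl a2 l"
      from arg_cong[OF this, of "\<lambda>r. co 0 (r centroid)"] show False
        unfolding co_refl_a1 co_refl_a2 co_centroid using n3(1)[of l] by linarith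
    qed
    show "aff_refl a1 k \<noteq> aff_refl (a1+a2) l"
    proof
      assume "aff_refl a1 k = aff_refl (a1+a2) l"
      from arg_cong[OF this, of "\<lambda>r. co 0 (r centroid)"] show False
        unfolding co_refl_a1 co_refl_a12 co_centroid using n3(2)[of l] by linarith
    qed
    show "aff_refl a2 k \<noteq> aff_refl (a1+a2) l"
    proof
      assume "aff_refl a2 k = aff_refl (a1+a2) l"
      from arg_cong[OF this, of "\<lambda>r. co 1 (r centroid)"] show False
        unfolding co_refl_a2 co_refl_a12 co_centroid using n3(2)[of l] by linarith
    qed
  qed
  have le: "bruhat_le a1 a2 (r \<circ> x) w \<longleftrightarrow> S (pos (r \<circ> x))" if "r \<in> reflections a1 a2" for r
    by (rule bruhat_le_iff_certificate[OF w S refl_comp_weyl[OF that x]])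
  have p2: "pos (aff_refl (a1+a2) (1-k) \<circ> x) = refl2 k (pos x)" for k
    using pos_refl(3)[of "1-k" x] by (simp only: diff_diff_eq2 add_diff_cancel_left')
  have "{r \<in> reflections a1 a2. bruhat_le a1 a2 (r \<circ> x) w} = ?f0 ` ?K0 \<union> ?f1 ` ?K1 \<union> ?f2 ` ?K2"
  proof (intro equalityI subsetI)
    fix r assume "r \<in> {r \<in> reflections a1 a2. bruhat_le a1 a2 (r \<circ> x) w}"
    then have r: "r \<in> reflections a1 a2" "S (pos (r \<circ> x))" using le by blast+
    from r(1) show "r \<in> ?f0 ` ?K0 \<union> ?f1 ` ?K1 \<union> ?f2 ` ?K2"
    proof (cases rule: reflections_cases)
      case (1 k)
      have "k \<in> ?K0" using r(2) unfolding 1 pos_refl by blast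
      then show ?thesis using 1 by blast
    next
      case (2 k)
      have "k \<in> ?K1" using r(2) unfolding 2 pos_refl by blast
      then show ?thesis using 2 by blast
    next
      case (3 k)
      have "1-k \<in> ?K2" using r(2) unfolding 3 pos_refl by blast
      moreover have "r = ?f2 (1-k)" unfolding 3 by simp
      ultimately show ?thesis by blast
    qed
  next
    fix r assume "r \<in> ?f0 ` ?K0 \<union> ?f1 ` ?K1 \<union> ?f2 ` ?K2"
    then obtain k where "(r = ?f0 k \<and> S (refl0 k (pos x))) \<or> (r = ?f1 k \<and> S (refl1 k (pos x))) \<or> (r = ?f2 k \<and> S (refl2 k (pos x)))" by blast
    then have "r \<in> reflections a1 a2 \<and> S (pos (r \<circ> x))"
      using pos_refl(1,2)[of k x] p2[of k] reflections_intros by metis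
    then show "r \<in> {r \<in> reflections a1 a2. bruhat_le a1 a2 (r \<circ> x) w}" using le by blast
  qed
  moreover have "card (?f0 ` ?K0 \<union> ?f1 ` ?K1 \<union> ?f2 ` ?K2) = card (?f0 ` ?K0) + card (?f1 ` ?K1) + card (?f2 ` ?K2)"
  proof -
    have "?f0 ` ?K0 \<inter> ?f1 ` ?K1 = {}" "(?f0 ` ?K0 \<union> ?f1 ` ?K1) \<inter> ?f2 ` ?K2 = {}"
      using ne by blast+
    then show ?thesis using fin by (simp add: card_Un_disjoint)
  qed
  ultimately show ?thesis unfolding refl_count_def refl_total_def
    by (simp add: card_image[OF inj_on_subset[OF inj(1) subset_UNIV]] card_image[OF inj_on_subset[OF inj(2) subset_UNIV]]
        card_image[OF inj_on_subset[OF inj(3) subset_UNIV]])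
qed

theorem defect_pos_lower:
  assumes w: "w \<in> affine_weyl a1 a2" "\<not> spiral a1 a2 w"
    and yx: "bruhat_le a1 a2 y x" and xw: "bruhat_le a1 a2 x w" and q: "refl_defect a1 a2 w x > 0"
  shows "refl_defect a1 a2 w y > 0"
proof -
  obtain a b c where p: "pos w = (a,b,c)" by (cases "pos w")
  obtain S where S: "certificate (pos w) S"
    using certificate_exists[of a b c] alcove_pos[OF w(1)] nonspiral_strips[OF w p] unfolding p by blast
  have x: "x \<in> affine_weyl a1 a2" and y: "y \<in> affine_weyl a1 a2" using yx unfolding bruhat_le_def by auto
  have d: "refl_defect a1 a2 w u > 0 \<longleftrightarrow> refl_total S (pos u) > height (pos w)" if "u \<in> affine_weyl a1 a2" for u
    unfolding refl_defect_def refl_count_certificate[OF w(1) S that] weyl_length_eq[OF w(1)] by linarith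
  note c = S[unfolded certificate_def]
  note c2 = conjunct1[OF conjunct2[OF c], rule_format]
    and c5 = conjunct2[OF conjunct2[OF conjunct2[OF conjunct2[OF c]]], rule_format]
  have "S (pos x) \<and> refl_total S (pos x) > height (pos w)"
    using bruhat_le_iff_certificate[OF w(1) S x] xw q d[OF x] by blast
  with yx have "S (pos y) \<and> refl_total S (pos y) > height (pos w)"
    by (rule bruhat_le_induct[where P = "\<lambda>p. S p \<and> refl_total S p > height (pos w)"]) (use c2 c5 in blast)
  then show ?thesis using d[OF y] by blast
qed

end

theorem theorem8p1:
  fixes a1 a2 :: "'a::euclidean_space" and w x y :: "'a \<Rightarrow> 'a"
  assumes "DIM('a) = 2"
    and "A2_simple_roots a1 a2"
    and "w \<in> affine_weyl a1 a2"
    and "\<not> spiral a1 a2 w"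
    and "bruhat_le a1 a2 y x"
    and "bruhat_le a1 a2 x w"
    and "refl_defect a1 a2 w x > 0"
  shows "refl_defect a1 a2 w y > 0"
proof -
  interpret A2_plane a1 a2
    using assms(1,2) by unfold_locales
  show ?thesis
    using defect_pos_lower[OF assms(3-7)] .
qed

end
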